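(* Let $r>0$, $s\in\mathbb N$, $a>0$. Then for any $q\in[1,\infty)$ such that $\lambda:=a-1/q>0$, and any $\varepsilon\in(0,1]$, $$n_\varepsilon\bigl(U^{r,a}(\mathbb I^s,w),L_2(\mathbb I^s,w)\bigr)\ \le\ q\,\lambda^{-qs}\,\varepsilon^{-(1+q)/r}.$$
   Context: $\mathbb N=\{1,2,\dots\}$, $\mathbb N_0=\mathbb N\cup\{0\}$, $\mathbb I^s=[-1,1]^s$. Fix $\alpha,\beta>-1$ and let $a:=(\alpha+\beta+1)/2$, assumed positive. $L_2(\mathbb I^s,w)$ is the Hilbert space with inner product $(f,g)_w=\int_{\mathbb I^s}f(\mathbf x)g(\mathbf x)w(\mathbf x)\,d\mathbf x$, where $w(\mathbf x)=\prod_{j=1}^s(1-x_j)^\alpha(1+x_j)^\beta$. $\{P^{(\alpha,\beta)}_k\}_{k\ge0}$ are the orthonormal Jacobi polynomials on $[-1,1]$ for the weight $(1-x)^\alpha(1+x)^\beta$; $P^{(\alpha,\beta)}_{\mathbf k}(\mathbf x)=\prod_{j=1}^sP^{(\alpha,\beta)}_{k_j}(x_j)$ for $\mathbf k\in\mathbb N_0^s$, and $f_{\mathbf k}=(f,P^{(\alpha,\beta)}_{\mathbf k})_w$. With $\lambda_a(\mathbf k):=\prod_{j=1}^s(a+k_j)$, $K^{r,a}(\mathbb I^s,w)$ is the space of $f\in L_2(\mathbb I^s,w)$ with finite norm $\|f\|_{K^{r,a}(\mathbb I^s,w)}=\bigl(\sum_{\mathbf k\in\mathbb N_0^s}\lambda_a(\mathbf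 k)^{2r}|f_{\mathbf k}|^2\bigr)^{1/2}$, and $U^{r,a}(\mathbb I^s,w)$ is its (closed) unit ball. For a normed space $X$ and $W\subset X$ centrally symmetric, $n_\varepsilon(W,X)$ is the smallest $n\in\mathbb N_0$ such that some linear subspace $L\subset X$ of dimension $\le n$ satisfies $\sup_{f\in W}\inf_{g\in L}\|f-g\|_X\le\varepsilon$. *)

theory Defs
  imports "HOL-Analysis.Analysis" "HOL-Library.Function_Algebras"
begin

text \<open>The pointwise real vector space of functions; the additive structure is the one of
  \<^theory>\<open>HOL-Library.Function_Algebras\<close>.\<close>

instantiation "fun" :: (type, real_vector) real_vector
begin

definition scaleR_fun :: "real \<Rightarrow> ('a \<Rightarrow> 'b) \<Rightarrow> 'a \<Rightarrow> 'b" where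
  "scaleR_fun c f = (\<lambda>x. c *\<^sub>R f x)"

instance
  by standard (simp_all add: scaleR_fun_def plus_fun_def fun_eq_iff scaleR_add_right scaleR_add_left)

end


section \<open>Information complexity\<close>

definition dim_at_most :: "'v::real_vector set \<Rightarrow> nat \<Rightarrow> bool" where
  \<comment> \<open>not expressed through \<^const>\<open>dim\<close>, which is \<open>0\<close> on infinite-dimensional subspaces\<close>
  "dim_at_most L n \<longleftrightarrow> (\<exists>B. finite B \<and> independent B \<and> span B = L \<and> card B \<le> n)"

text \<open>The normed space is given by a linear subspace \<open>X\<close> of a real vector space and its norm \<open>N\<close>.
  \<open>N\<close> may be a seminorm, standing for the norm on \<open>X\<close> modulo \<open>{f \<in> X. N f = 0}\<close>. The value of
  \<open>n_eps\<close> is not affected by passing to this quotient: the image of a subspace has at most its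
  dimension, a finite-dimensional subspace of the quotient is the image of a subspace of the same
  dimension, and the distances agree. The value is \<open>\<infinity>\<close> if no finite \<open>n\<close> is admissible.\<close>

definition n_eps :: "real \<Rightarrow> 'v::real_vector set \<Rightarrow> 'v set \<Rightarrow> ('v \<Rightarrow> real) \<Rightarrow> enat" where
  "n_eps \<epsilon> W X N =
     (INF n \<in> {n. \<exists>L. subspace L \<and> L \<subseteq> X \<and> dim_at_most L n \<and>
                     (SUP f\<in>W. INF g\<in>L. ereal (N (f - g))) \<le> ereal \<epsilon>}. enat n)"


section \<open>Real square integrable functions\<close>

definition L2_space :: "'a measure \<Rightarrow> ('a \<Rightarrow> real) set" where
  "L2_space M = {f \<in> borel_measurable M. integrable M (\<lambda>x. (f x)\<^sup>2)}"

definition L2_inner :: "'a measure \<Rightarrow> ('a \<Rightarrow> real) \<Rightarrow> ('a \<Rightarrow> real) \<Rightarrow> real" where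
  "L2_inner M f g = (\<integral>x. f x * g x \<partial>M)"

definition L2_norm :: "'a measure \<Rightarrow> ('a \<Rightarrow> real) \<Rightarrow> real" where
  "L2_norm M f = sqrt (L2_inner M f f)"


section \<open>Jacobi weights and orthonormal Jacobi polynomials\<close>

definition jacobi_weight1 :: "real \<Rightarrow> real \<Rightarrow> real \<Rightarrow> real" where
  "jacobi_weight1 \<alpha> \<beta> t = (1 - t) powr \<alpha> * (1 + t) powr \<beta>"

definition jacobi_measure1 :: "real \<Rightarrow> real \<Rightarrow> real measure" where
  "jacobi_measure1 \<alpha> \<beta> =
     density lborel (\<lambda>t. ennreal (indicator {-1..1} t * jacobi_weight1 \<alpha> \<beta> t))"

text \<open>Orthonormality and the degree determine the polynomials up to sign only; the sign is fixed
  by a positive leading coefficient.\<close>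

definition jacobi_poly :: "real \<Rightarrow> real \<Rightarrow> nat \<Rightarrow> real poly" where
  "jacobi_poly \<alpha> \<beta> = (THE P.
     (\<forall>k. degree (P k) = k \<and> lead_coeff (P k) > 0) \<and>
     (\<forall>j k. L2_inner (jacobi_measure1 \<alpha> \<beta>) (poly (P j)) (poly (P k)) = (if j = k then 1 else 0)))"

definition unit_cube :: "(real ^ 's) set" where
  "unit_cube = {x. \<forall>j. x $ j \<in> {-1..1}}"

definition jacobi_weight :: "real \<Rightarrow> real \<Rightarrow> real ^ 's \<Rightarrow> real" where
  "jacobi_weight \<alpha> \<beta> x = (\<Prod>j\<in>UNIV. (1 - x $ j) powr \<alpha> * (1 + x $ j) powr \<beta>)"

text \<open>The measure \<open>w(x) dx\<close> on the cube, extended by zero to the whole space: values of functions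
  off the cube are irrelevant.\<close>

definition jacobi_measure :: "real \<Rightarrow> real \<Rightarrow> (real ^ 's) measure" where
  "jacobi_measure \<alpha> \<beta> =
     density lborel (\<lambda>x. ennreal (indicator unit_cube x * jacobi_weight \<alpha> \<beta> x))"

definition jacobi_tensor :: "real \<Rightarrow> real \<Rightarrow> nat ^ 's \<Rightarrow> real ^ 's \<Rightarrow> real" where
  "jacobi_tensor \<alpha> \<beta> k x = (\<Prod>j\<in>UNIV. poly (jacobi_poly \<alpha> \<beta> (k $ j)) (x $ j))"

definition jacobi_coeff :: "real \<Rightarrow> real \<Rightarrow> (real ^ 's \<Rightarrow> real) \<Rightarrow> nat ^ 's \<Rightarrow> real" where
  "jacobi_coeff \<alpha> \<beta> f k = L2_inner (jacobi_measure \<alpha> \<beta>) f (jacobi_tensor \<alpha> \<beta> k)"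


section \<open>The space of functions of mixed smoothness\<close>

definition lambda_a :: "real \<Rightarrow> nat ^ 's \<Rightarrow> real" where
  "lambda_a a k = (\<Prod>j\<in>UNIV. a + real (k $ j))"

definition K_space :: "real \<Rightarrow> real \<Rightarrow> real \<Rightarrow> real \<Rightarrow> (real ^ 's \<Rightarrow> real) set" where
  "K_space \<alpha> \<beta> r a = {f \<in> L2_space (jacobi_measure \<alpha> \<beta>).
     (\<lambda>k. lambda_a a k powr (2 * r) * \<bar>jacobi_coeff \<alpha> \<beta> f k\<bar>\<^sup>2) summable_on UNIV}"

definition K_norm :: "real \<Rightarrow> real \<Rightarrow> real \<Rightarrow> real \<Rightarrow> (real ^ 's \<Rightarrow> real) \<Rightarrow> real" where
  "K_norm \<alpha> \<beta> r a f =
     sqrt (\<Sum>\<^sub>\<infinity>k. lambda_a a k powr (2 * r) * \<bar>jacobi_coeff \<alpha> \<beta> f k\<bar>\<^sup>2)"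

definition U_ball :: "real \<Rightarrow> real \<Rightarrow> real \<Rightarrow> real \<Rightarrow> (real ^ 's \<Rightarrow> real) set" where
  "U_ball \<alpha> \<beta> r a = {f \<in> K_space \<alpha> \<beta> r a. K_norm \<alpha> \<beta> r a f \<le> 1}"

end

theory Submission
  imports Defs
begin

text \<open>The approximating subspace is spanned by the tensor Jacobi polynomials with index in the
  hyperbolic cross \<open>{k. lambda_a a k < T}\<close>, where \<open>T = \<epsilon> powr (- 1 / r)\<close>. Outside the cross
  \<open>\<epsilon>\<^sup>2 * lambda_a a k powr (2 * r) \<ge> 1\<close>, so by Parseval the truncation error of \<open>f\<close> is at
  most \<open>\<epsilon>\<close> times its \<open>K\<close>-norm; Parseval rests on the density of polynomials in \<open>L\<^sub>2\<close>.
  The cross is counted by Rankin's trick: its indicator is at most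
  \<open>(T / lambda_a a k) powr (1 + q)\<close>, whose sum factorises into
  \<open>T powr (1 + q) * \<zeta>(1 + q, a) ^ s\<close> with the Hurwitz zeta function, and
  \<open>\<zeta>(1 + q, a) \<le> a powr (- q) * (1 / a + 1 / q) \<le> (a - 1 / q) powr (- q)\<close>,
  the last step by Bernoulli's inequality.\<close>

section \<open>Counting points in the hyperbolic cross\<close>

text \<open>Write the power as an exponential of \<open>- q * ln (1 - u)\<close> and use the tangent
  bounds \<open>ln x \<le> x - 1\<close> and \<open>1 + x \<le> exp x\<close>. Negative
  \<open>u\<close> is covered as well.\<close>

lemma bernoulli_powr_neg:
  fixes u q :: real
  assumes "0 \<le> q" "u < 1"
  shows "1 + q * u \<le> (1 - u) powr (- q)"
proof -
  have "u \<le> - ln (1 - u)"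
    using ln_le_minus_one[of "1 - u"] assms by simp
  then have "1 + q * u \<le> 1 + (- q) * ln (1 - u)"
    using mult_left_mono[OF _ assms(1)] by fastforce
  also have "\<dots> \<le> exp ((- q) * ln (1 - u))"
    by (rule exp_ge_add_one_self)
  finally show ?thesis
    using assms by (simp add: powr_def)
qed

text \<open>Comparison with an integral: the summand with index 0 is kept, and the quotient by
  \<open>q\<close> is the integral of \<open>x powr (- (1 + q))\<close> over the interval from
  \<open>a\<close> to \<open>a + n\<close>. Each induction step compares one summand with the
  integral over one unit interval, and Bernoulli's inequality does this without any
  integration.\<close>

lemma hurwitz_zeta_partial_le:
  fixes a q :: real
  assumes "a > 0" "q > 0"
  shows "(\<Sum>k\<le>n. (a + real k) powr (- (1 + q)))
           \<le> a powr (- (1 + q)) + (a powr (- q) - (a + real n) powr (- q)) / q"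
proof (induction n)
  case (Suc n)
  define y where "y = a + real n + 1"
  have y: "y > 1" using assms by (simp add: y_def)
  \<comment> \<open>Multiplied by \<open>y powr (- q)\<close>, this bounds the new summand by the
    integral over \<open>[y - 1, y]\<close>.\<close>
  have *: "1 + q * (1 / y) \<le> (1 - 1 / y) powr (- q)"
    using y assms by (intro bernoulli_powr_neg) auto
  have "(1 - 1 / y) powr (- q) * y powr (- q) = (y - 1) powr (- q)"
  proof -
    have "(1 - 1 / y) * y = y - 1" using y by (simp add: field_simps)
    then show ?thesis using y powr_mult[of "1 - 1 / y" y "- q"] by simp
  qed
  moreover have "(1 + q * (1 / y)) * y powr (- q) = y powr (- q) + q * y powr (- (1 + q))"
  proof -
    have "y powr (- q) = y * y powr (- (1 + q))"
      using y by (simp add: powr_mult_base)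
    then show ?thesis using y by (simp add: field_simps)
  qed
  ultimately have "y powr (- (1 + q)) \<le> ((y - 1) powr (- q) - y powr (- q)) / q"
    using mult_right_mono[OF *, of "y powr (- q)"] assms by (simp add: field_simps)
  with Suc show ?case
    by (simp add: y_def diff_divide_distrib algebra_simps)
qed simp

lemma hurwitz_zeta_partial_le_powr:
  fixes a q :: real
  assumes "q \<ge> 1" "a - 1 / q > 0"
  shows "(\<Sum>k\<le>n. (a + real k) powr (- (1 + q))) \<le> (a - 1 / q) powr (- q)"
proof -
  have "0 < 1 / q" using assms by simp
  then have a: "a > 0" using assms by linarith
  have u: "1 / (q * a) < 1" using assms a by (simp add: field_simps)
  have "(\<Sum>k\<le>n. (a + real k) powr (- (1 + q))) \<le> a powr (- (1 + q)) + a powr (- q) / q"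
    using hurwitz_zeta_partial_le[of a q n] a assms by (simp add: diff_divide_distrib)
      (smt (verit) divide_nonneg_pos powr_ge_zero)
  also have "\<dots> = a powr (- q) * (1 / a + 1 / q)"
  proof -
    have "a powr (- q) = a * a powr (- (1 + q))"
      using a by (simp add: powr_mult_base)
    then show ?thesis using a by (simp add: field_simps)
  qed
  \<comment> \<open>Here \<open>1 / q \<le> 1\<close> because \<open>q \<ge> 1\<close>, and
    \<open>1 / a\<close> is written as \<open>q * u\<close> with \<open>u = 1 / (q * a)\<close> to
    fit Bernoulli's inequality. This \<open>u\<close> is right because
    \<open>a * (1 - u) = a - 1 / q\<close>.\<close>
  also have "\<dots> \<le> a powr (- q) * (1 + q * (1 / (q * a)))"
    using assms a by (intro mult_left_mono) auto
  also have "\<dots> \<le> a powr (- q) * (1 - 1 / (q * a)) powr (- q)"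
    using assms u by (intro mult_left_mono bernoulli_powr_neg) auto
  also have "\<dots> = (a - 1 / q) powr (- q)"
  proof -
    have "a * (1 - 1 / (q * a)) = a - 1 / q" using a assms by (simp add: right_diff_distrib)
    then show ?thesis using a u powr_mult[of a "1 - 1 / (q * a)" "- q"] by simp
  qed
  finally show ?thesis .
qed

lemma lambda_a_pos: "a > 0 \<Longrightarrow> lambda_a a k > 0"
  unfolding lambda_a_def by (intro prod_pos) (auto intro: add_pos_nonneg)

text \<open>Finiteness and the count come from one bound on the cardinality of all finite subsets
  \<open>G\<close> of the cross. Working with finite \<open>G\<close> means that only partial sums
  of the zeta series occur.\<close>

lemma hyperbolic_cross_finite_card:
  fixes a q T :: real
  assumes "q \<ge> 1" "a - 1 / q > 0" "T > 0"
  defines "K \<equiv> {k :: nat ^ 's. lambda_a a k < T}"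
  shows "finite K \<and> real (card K) \<le> T powr (1 + q) * (a - 1 / q) powr (- (q * real CARD('s)))"
proof -
  let ?B = "T powr (1 + q) * (a - 1 / q) powr (- (q * real CARD('s)))"
  have "0 < 1 / q" using assms by simp
  then have a: "a > 0" using assms by linarith
  have bound: "real (card G) \<le> ?B" if G: "G \<subseteq> K" "finite G" for G
  proof -
    \<comment> \<open>A crude common bound for all coordinates of all points of \<open>G\<close>; it
      encloses \<open>G\<close> in the box \<open>{..n} ^ s\<close>. It disappears later, as the
      bound on the partial sums is uniform in \<open>n\<close>.\<close>
    define n where "n = (\<Sum>k\<in>G. \<Sum>j\<in>UNIV. k $ j)"
    have le_n: "k $ j \<le> n" if "k \<in> G" for k j
      unfolding n_def using G(2) that
      by (intro order.trans[OF member_le_sum[of j UNIV "\<lambda>j. k $ j"] member_le_sum[of k G "\<lambda>k. \<Sum>j\<in>UNIV. k $ j"]]) auto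
    \<comment> \<open>Rankin's trick: \<open>T / lambda_a a k\<close> exceeds 1 on the cross, and so
      does its power with positive exponent \<open>1 + q\<close>.\<close>
    have one_le: "1 \<le> T powr (1 + q) * lambda_a a k powr (- (1 + q))" if "k \<in> G" for k
    proof -
      have "1 \<le> (T / lambda_a a k) powr (1 + q)"
        using that G lambda_a_pos[OF a, of k] assms
            by (intro ge_one_powr_ge_zero) (auto simp: K_def field_simps)
      also have "\<dots> = T powr (1 + q) * lambda_a a k powr (- (1 + q))"
        using lambda_a_pos[OF a, of k] assms
            by (subst powr_divide) (auto simp: powr_minus divide_inverse simp del: minus_add_distrib)
      finally show ?thesis .
    qed
    \<comment> \<open>Vectors become functions, so that the sum can be enlarged to the full function
      space \<open>Pi\<^sub>E\<close> over the box and factorised by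
      \<open>prod_sum_PiE\<close>.\<close>
    have inj: "inj_on vec_nth G"
      by (simp add: inj_on_def vec_nth_inject)
    have "real (card G) \<le> (\<Sum>k\<in>G. T powr (1 + q) * lambda_a a k powr (- (1 + q)))"
      using sum_mono[of G "\<lambda>_. 1::real", OF one_le] by simp
    also have "\<dots> = T powr (1 + q) * (\<Sum>k\<in>G. \<Prod>j\<in>UNIV. (a + real (k $ j)) powr (- (1 + q)))"
      unfolding sum_distrib_left lambda_a_def using a
      by (subst prod_powr_distrib) (auto intro: add_nonneg_nonneg)
    also have "(\<Sum>k\<in>G. \<Prod>j\<in>UNIV. (a + real (k $ j)) powr (- (1 + q)))
        = (\<Sum>h\<in>vec_nth ` G. \<Prod>j\<in>UNIV. (a + real (h j)) powr (- (1 + q)))"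
      by (simp add: sum.reindex[OF inj])
    also have "\<dots> \<le> (\<Sum>h\<in>Pi\<^sub>E (UNIV::'s set) (\<lambda>_. {..n}). \<Prod>j\<in>UNIV. (a + real (h j)) powr (- (1 + q)))"
    proof (rule sum_mono2)
      show "vec_nth ` G \<subseteq> Pi\<^sub>E UNIV (\<lambda>_. {..n})" using le_n by auto
    qed (auto intro!: finite_PiE prod_nonneg)
    also have "\<dots> = (\<Prod>j\<in>(UNIV::'s set). \<Sum>k\<le>n. (a + real k) powr (- (1 + q)))"
      by (rule prod_sum_PiE[symmetric]) auto
    also have "\<dots> = (\<Sum>k\<le>n. (a + real k) powr (- (1 + q))) ^ CARD('s)"
      by simp
    also have "\<dots> \<le> ((a - 1 / q) powr (- q)) ^ CARD('s)"
      using assms by (intro power_mono hurwitz_zeta_partial_le_powr sum_nonneg) auto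
    also have "\<dots> = (a - 1 / q) powr (- (q * real CARD('s)))"
      using assms by (simp add: powr_realpow[symmetric] powr_powr)
    finally show ?thesis by (simp add: mult_left_mono)
  qed
  \<comment> \<open>A set whose finite subsets have bounded size is finite. The floor is taken
    because that bound has to be a natural number; applying \<open>bound\<close> to \<open>K\<close>
    itself afterwards recovers the real bound.\<close>
  have "finite K \<and> card K \<le> nat \<lfloor>?B\<rfloor>"
  proof (rule finite_if_finite_subsets_card_bdd)
    fix G assume "G \<subseteq> K" "finite G"
    from bound[OF this] show "card G \<le> nat \<lfloor>?B\<rfloor>"
      by (simp add: le_nat_floor)
  qed
  then show ?thesis using bound by auto
qed


section \<open>Dense function algebras in \<open>L\<^sub>2\<close>\<close>

lemma L2_space_add:
  assumes "f \<in> L2_space M" "g \<in> L2_space M"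
  shows "(\<lambda>x. f x + g x) \<in> L2_space M"
proof -
  from assms have [measurable]: "f \<in> borel_measurable M" "g \<in> borel_measurable M"
    by (auto simp: L2_space_def)
  have "integrable M (\<lambda>x. (f x + g x)\<^sup>2)"
  proof (rule Bochner_Integration.integrable_bound)
    show "integrable M (\<lambda>x. 2 * (f x)\<^sup>2 + 2 * (g x)\<^sup>2)"
      using assms by (auto simp: L2_space_def)
    have "(f x + g x)\<^sup>2 \<le> 2 * (f x)\<^sup>2 + 2 * (g x)\<^sup>2" for x
      using zero_le_power2[of "f x - g x"] by (simp add: power2_sum power2_diff)
    then show "AE x in M. norm ((f x + g x)\<^sup>2) \<le> norm (2 * (f x)\<^sup>2 + 2 * (g x)\<^sup>2)"
      by auto
  qed measurable
  then show ?thesis by (auto simp: L2_space_def)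
qed

lemma L2_space_scale:
  assumes "f \<in> L2_space M"
  shows "(\<lambda>x. c * f x) \<in> L2_space M"
  using assms by (auto simp: L2_space_def power_mult_distrib)

lemma L2_space_diff:
  assumes "f \<in> L2_space M" "g \<in> L2_space M"
  shows "(\<lambda>x. f x - g x) \<in> L2_space M"
  using L2_space_add[OF assms(1) L2_space_scale[OF assms(2), of "-1"]] by simp

lemma L2_space_sum:
  assumes "\<And>i. i \<in> I \<Longrightarrow> f i \<in> L2_space M"
  shows "(\<lambda>x. \<Sum>i\<in>I. f i x) \<in> L2_space M"
  using assms
proof (induction I rule: infinite_finite_induct)
  case (insert i I)
  then show ?case using L2_space_add[of "f i" M "\<lambda>x. \<Sum>i\<in>I. f i x"] by simp
qed (simp_all add: L2_space_def)

lemma subspace_L2_space: "subspace (L2_space M)"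
proof (rule subspaceI)
  show "0 \<in> L2_space M" by (simp add: L2_space_def zero_fun_def)
  show "f + g \<in> L2_space M" if "f \<in> L2_space M" "g \<in> L2_space M" for f g
    using L2_space_add[OF that] by (simp add: plus_fun_def)
  show "c *\<^sub>R f \<in> L2_space M" if "f \<in> L2_space M" for c f
    using L2_space_scale[OF that] by (simp add: scaleR_fun_def)
qed

lemma integrable_mult_L2_space:
  assumes "f \<in> L2_space M" "g \<in> L2_space M"
  shows "integrable M (\<lambda>x. f x * g x)"
proof -
  have "(\<lambda>x. f x * g x) = (\<lambda>x. ((f x + g x)\<^sup>2 - (f x - g x)\<^sup>2) / 4)"
    by (auto simp: power2_eq_square algebra_simps)
  moreover have "integrable M (\<lambda>x. ((f x + g x)\<^sup>2 - (f x - g x)\<^sup>2) / 4)"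
    using L2_space_add[OF assms] L2_space_diff[OF assms] by (auto simp: L2_space_def)
  ultimately show ?thesis by simp
qed

lemma L2_inner_commute: "L2_inner M f g = L2_inner M g f"
  by (simp add: L2_inner_def mult.commute)

lemma L2_inner_self_nonneg: "0 \<le> L2_inner M f f"
  unfolding L2_inner_def by (intro integral_nonneg_AE) auto

lemma L2_inner_add_left:
  assumes "f \<in> L2_space M" "g \<in> L2_space M" "h \<in> L2_space M"
  shows "L2_inner M (\<lambda>x. f x + g x) h = L2_inner M f h + L2_inner M g h"
  unfolding L2_inner_def using assms
  by (simp add: distrib_right integrable_mult_L2_space)

lemma L2_inner_diff_left:
  assumes "f \<in> L2_space M" "g \<in> L2_space M" "h \<in> L2_space M"
  shows "L2_inner M (\<lambda>x. f x - g x) h = L2_inner M f h - L2_inner M g h"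
  unfolding L2_inner_def using assms
  by (simp add: left_diff_distrib integrable_mult_L2_space)

lemma L2_inner_scale_left: "L2_inner M (\<lambda>x. c * f x) h = c * L2_inner M f h"
  unfolding L2_inner_def by (simp add: mult.assoc)

lemma L2_inner_add_right:
  assumes "f \<in> L2_space M" "g \<in> L2_space M" "h \<in> L2_space M"
  shows "L2_inner M h (\<lambda>x. f x + g x) = L2_inner M h f + L2_inner M h g"
  using L2_inner_add_left[OF assms] by (simp only: L2_inner_commute[of M h])

lemma L2_inner_diff_right:
  assumes "f \<in> L2_space M" "g \<in> L2_space M" "h \<in> L2_space M"
  shows "L2_inner M h (\<lambda>x. f x - g x) = L2_inner M h f - L2_inner M h g"
  using L2_inner_diff_left[OF assms] by (simp only: L2_inner_commute[of M h])

lemma L2_inner_scale_right: "L2_inner M h (\<lambda>x. c * f x) = c * L2_inner M h f"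
  using L2_inner_scale_left by (simp only: L2_inner_commute[of M h])

lemma L2_inner_sum_left:
  assumes "\<And>i. i \<in> I \<Longrightarrow> f i \<in> L2_space M" "h \<in> L2_space M"
  shows "L2_inner M (\<lambda>x. \<Sum>i\<in>I. f i x) h = (\<Sum>i\<in>I. L2_inner M (f i) h)"
  unfolding L2_inner_def using assms
  by (simp add: sum_distrib_right integrable_mult_L2_space)

lemma L2_inner_lincomb:
  assumes "\<And>i. i \<in> I \<Longrightarrow> e i \<in> L2_space M" "h \<in> L2_space M"
  shows "L2_inner M (\<lambda>x. \<Sum>i\<in>I. c i * e i x) h
      = (\<Sum>i\<in>I. c i * L2_inner M (e i) h)"
  using assms by (subst L2_inner_sum_left) (auto intro: L2_space_scale simp: L2_inner_scale_left)

text \<open>Pythagoras with the square completed in the coefficients \<open>c i\<close>. It serves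
  two purposes: with the Fourier coefficients as \<open>c\<close> the last sum vanishes and the
  truncation error remains, while for any other \<open>c\<close> that sum is nonnegative, so no
  combination over \<open>I\<close> comes closer to \<open>f\<close>.\<close>

lemma L2_dist_orthonormal_lincomb:
  assumes "finite I" and f: "f \<in> L2_space M"
    and e: "\<And>i. i \<in> I \<Longrightarrow> e i \<in> L2_space M"
    and on: "\<And>i j. i \<in> I \<Longrightarrow> j \<in> I \<Longrightarrow> L2_inner M (e i) (e j)
        = (if i = j then 1 else 0)"
  shows "L2_inner M (\<lambda>x. f x - (\<Sum>i\<in>I. c i * e i x)) (\<lambda>x. f x - (\<Sum>i\<in>I. c i * e i x))
    = L2_inner M f f - (\<Sum>i\<in>I. (L2_inner M f (e i))\<^sup>2) + (\<Sum>i\<in>I. (L2_inner M f (e i) - c i)\<^sup>2)"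
proof -
  let ?S = "\<lambda>x. \<Sum>i\<in>I. c i * e i x"
  have S: "?S \<in> L2_space M" using e by (intro L2_space_sum L2_space_scale)
  have 1: "L2_inner M ?S f = (\<Sum>i\<in>I. c i * L2_inner M f (e i))"
    using e f by (simp add: L2_inner_lincomb L2_inner_commute[of M f])
  have eS: "L2_inner M (e i) ?S = c i" if i: "i \<in> I" for i
  proof -
    have "L2_inner M (e i) ?S = (\<Sum>j\<in>I. c j * L2_inner M (e j) (e i))"
      unfolding L2_inner_commute[of M "e i" ?S] using e i by (intro L2_inner_lincomb)
    also have "\<dots> = c i"
      using i assms(1) by (simp add: on if_distrib sum.delta' cong: if_cong)
    finally show ?thesis .
  qed
  have 2: "L2_inner M ?S ?S = (\<Sum>i\<in>I. (c i)\<^sup>2)"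
    using e S by (simp add: L2_inner_lincomb eS power2_eq_square)
  have "L2_inner M (\<lambda>x. f x - ?S x) (\<lambda>x. f x - ?S x)
     = L2_inner M f f - L2_inner M ?S f - (L2_inner M ?S f - L2_inner M ?S ?S)"
    using f S L2_space_diff[OF f S] L2_inner_commute[of M f ?S]
    by (simp add: L2_inner_diff_left L2_inner_diff_right)
  then show ?thesis
    unfolding 1 2 by (simp add: power2_diff sum.distrib sum_subtractf sum_negf sum_distrib_left mult_ac)
qed

section \<open>Approximation in mean square, extended from a function algebra to all of
  \<open>L2_space M\<close>\<close>

definition L2_approx :: "'a measure \<Rightarrow> ('a \<Rightarrow> real) set \<Rightarrow> ('a \<Rightarrow> real) \<Rightarrow> bool" where
  "L2_approx M R f \<longleftrightarrow> (\<forall>\<eta>>0. \<exists>g\<in>R. L2_inner M (\<lambda>x. f x - g x) (\<lambda>x. f x - g x) < \<eta>)"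

text \<open>The parallelogram law with one nonnegative term dropped. It stands in for the triangle
  inequality, since \<open>L2_approx\<close> measures squared distances; two errors below
  \<open>\<eta> / 4\<close> add up to one below \<open>\<eta>\<close>.\<close>

lemma L2_inner_self_add_le:
  assumes "f \<in> L2_space M" "g \<in> L2_space M"
  shows "L2_inner M (\<lambda>x. f x + g x) (\<lambda>x. f x + g x)
      \<le> 2 * L2_inner M f f + 2 * L2_inner M g g"
proof -
  have "0 \<le> L2_inner M (\<lambda>x. f x - g x) (\<lambda>x. f x - g x)"
      by (rule L2_inner_self_nonneg)
  moreover have "L2_inner M (\<lambda>x. f x + g x) (\<lambda>x. f x + g x) + L2_inner M (\<lambda>x. f x - g x) (\<lambda>x. f x - g x)
     = 2 * L2_inner M f f + 2 * L2_inner M g g"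
    using assms L2_space_add[OF assms] L2_space_diff[OF assms]
    by (simp add: L2_inner_add_left L2_inner_add_right L2_inner_diff_left L2_inner_diff_right)
  ultimately show ?thesis by linarith
qed

text \<open>\<open>function_ring_on\<close> makes \<open>S\<close> compact and \<open>R\<close> an
  algebra of functions, continuous on \<open>S\<close>, which contains the constants and separates
  the points of \<open>S\<close>: the setting of Stone-Weierstrass. Uniform approximation is
  available on \<open>S\<close> only, hence the demand that \<open>S\<close> carries the
  measure.\<close>

locale L2_dense =
  fixes M :: "'a :: {metric_space, second_countable_topology} measure"
    and R :: "('a \<Rightarrow> real) set" and S :: "'a set"
  assumes sets_M: "sets M = sets borel" and finite_M: "finite_measure M"
    and supp: "AE x in M. x \<in> S"
    and ring: "function_ring_on R S"
    and R_L2: "R \<subseteq> L2_space M"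
begin

lemma measurable_M: "f \<in> borel_measurable borel \<Longrightarrow> f \<in> borel_measurable M"
  using measurable_cong_sets[OF sets_M refl] by blast

lemma R_in_L2: "g \<in> R \<Longrightarrow> g \<in> L2_space M" using R_L2 by auto

lemma approx_add:
  assumes "L2_approx M R f" "L2_approx M R g" "f \<in> L2_space M" "g \<in> L2_space M"
  shows "L2_approx M R (\<lambda>x. f x + g x)"
  unfolding L2_approx_def
proof (intro allI impI)
  fix \<eta> :: real assume "\<eta> > 0"
  then obtain f' g' where f': "f' \<in> R" "L2_inner M (\<lambda>x. f x - f' x) (\<lambda>x. f x - f' x) < \<eta> / 4"
    and g': "g' \<in> R" "L2_inner M (\<lambda>x. g x - g' x) (\<lambda>x. g x - g' x) < \<eta> / 4"
    using assms(1,2) unfolding L2_approx_def by (meson zero_less_divide_iff zero_less_numeral)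
  have "L2_inner M (\<lambda>x. (f x - f' x) + (g x - g' x)) (\<lambda>x. (f x - f' x) + (g x - g' x)) < \<eta>"
    using L2_inner_self_add_le[OF L2_space_diff[OF assms(3) R_in_L2[OF f'(1)]] L2_space_diff[OF assms(4) R_in_L2[OF g'(1)]]]
      f'(2) g'(2) by linarith
  moreover have "(\<lambda>x. f' x + g' x) \<in> R"
    using function_ring_on.add[OF ring] f' g' by auto
  ultimately show "\<exists>h\<in>R. L2_inner M (\<lambda>x. f x + g x - h x) (\<lambda>x. f x + g x - h x) < \<eta>"
    by (intro bexI[of _ "\<lambda>x. f' x + g' x"]) (simp_all add: algebra_simps)
qed

lemma approx_scale:
  assumes "L2_approx M R f"
  shows "L2_approx M R (\<lambda>x. c * f x)"
  unfolding L2_approx_def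
proof (intro allI impI)
  fix \<eta> :: real assume "\<eta> > 0"
  \<comment> \<open>Dividing by \<open>1 + c\<^sup>2\<close> instead of \<open>c\<^sup>2\<close>
    includes the case \<open>c = 0\<close>.\<close>
  then have "\<eta> / (1 + c\<^sup>2) > 0" by (auto simp: add_pos_nonneg)
  then obtain g where g: "g \<in> R" "L2_inner M (\<lambda>x. f x - g x) (\<lambda>x. f x - g x) < \<eta> / (1 + c\<^sup>2)"
    using assms unfolding L2_approx_def by blast
  let ?I = "L2_inner M (\<lambda>x. f x - g x) (\<lambda>x. f x - g x)"
  have "L2_inner M (\<lambda>x. c * (f x - g x)) (\<lambda>x. c * (f x - g x)) = c\<^sup>2 * ?I"
    by (simp add: L2_inner_scale_left L2_inner_scale_right power2_eq_square)
  also have "\<dots> \<le> (1 + c\<^sup>2) * ?I"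
    using L2_inner_self_nonneg[of M] by (intro mult_right_mono) auto
  also have "\<dots> < \<eta>"
    using g(2) by (simp add: field_simps add_pos_nonneg)
  finally have "L2_inner M (\<lambda>x. c * f x - c * g x) (\<lambda>x. c * f x - c * g x) < \<eta>"
    by (simp add: right_diff_distrib)
  moreover have "(\<lambda>x. c * g x) \<in> R"
    using function_ring_on.mult[OF ring function_ring_on.const[OF ring]] g by auto
  ultimately show "\<exists>h\<in>R. L2_inner M (\<lambda>x. c * f x - h x) (\<lambda>x. c * f x - h x) < \<eta>"
    by (intro bexI[of _ "\<lambda>x. c * g x"])
qed

text \<open>The limit \<open>f\<close> inherits the majorant \<open>h\<close>, so
  \<open>(2 * h x)\<^sup>2\<close> dominates the squared differences and dominated convergence gives
  convergence in mean square. All later extensions to larger classes of functions pass through this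
  closure property.\<close>

lemma approx_limit:
  assumes f: "f \<in> borel_measurable M"
    and g: "\<And>n. g n \<in> L2_space M" "\<And>n. L2_approx M R (g n)"
    and lim: "\<And>x. x \<in> space M
        \<Longrightarrow> (\<lambda>n. g n x) \<longlonglongrightarrow> f x"
    and h: "h \<in> L2_space M" "\<And>n x. x \<in> space M
        \<Longrightarrow> \<bar>g n x\<bar> \<le> h x"
  shows "L2_approx M R f"
  unfolding L2_approx_def
proof (intro allI impI)
  fix \<eta> :: real assume \<eta>: "\<eta> > 0"
  note [measurable] = f
  have [measurable]: "g n \<in> borel_measurable M" for n using g(1) by (simp add: L2_space_def)
  have fh: "\<bar>f x\<bar> \<le> h x" if "x \<in> space M" for x
    using tendsto_rabs[OF lim[OF that]] h(2)[OF that] by (intro LIMSEQ_le_const2) auto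
  have fL2: "f \<in> L2_space M"
  proof -
    have "integrable M (\<lambda>x. (f x)\<^sup>2)"
    proof (rule Bochner_Integration.integrable_bound)
      show "integrable M (\<lambda>x. (h x)\<^sup>2)" using h(1) by (simp add: L2_space_def)
      show "AE x in M. norm ((f x)\<^sup>2) \<le> norm ((h x)\<^sup>2)"
      proof (rule AE_I2)
        fix x assume "x \<in> space M"
        from power_mono[OF fh[OF this], of 2] show "norm ((f x)\<^sup>2) \<le> norm ((h x)\<^sup>2)"
          by simp
      qed
    qed measurable
    then show ?thesis using f by (simp add: L2_space_def)
  qed
  have "(\<lambda>n. \<integral>x. (f x - g n x)\<^sup>2 \<partial>M) \<longlonglongrightarrow> (\<integral>x. 0 \<partial>M)"
  proof (rule integral_dominated_convergence)
    show "integrable M (\<lambda>x. (2 * h x)\<^sup>2)" using L2_space_scale[OF h(1), of 2]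
        by (simp add: L2_space_def)
    show "AE x in M. (\<lambda>n. (f x - g n x)\<^sup>2) \<longlonglongrightarrow> 0"
    proof (rule AE_I2)
      fix x assume "x \<in> space M"
      from tendsto_power[OF tendsto_diff[OF tendsto_const lim[OF this]], of "f x" 2]
      show "(\<lambda>n. (f x - g n x)\<^sup>2) \<longlonglongrightarrow> 0" by simp
    qed
    show "AE x in M. norm ((f x - g n x)\<^sup>2) \<le> (2 * h x)\<^sup>2" for n
    proof (rule AE_I2)
      fix x assume x: "x \<in> space M"
      have "\<bar>f x - g n x\<bar> \<le> 2 * h x" using fh[OF x] h(2)[OF x, of n] by linarith
      from power_mono[OF this, of 2] show "norm ((f x - g n x)\<^sup>2) \<le> (2 * h x)\<^sup>2" by simp
    qed
  qed measurable
  then have "\<forall>\<^sub>F n in sequentially. (\<integral>x. (f x - g n x)\<^sup>2 \<partial>M) < \<eta> / 4"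
    using \<eta> by (intro order_tendstoD) auto
  then obtain n where n: "L2_inner M (\<lambda>x. f x - g n x) (\<lambda>x. f x - g n x) < \<eta> / 4"
    unfolding L2_inner_def power2_eq_square[symmetric] by (meson eventually_sequentially order_refl)
  from g(2)[of n] \<eta> obtain k where k: "k \<in> R" "L2_inner M (\<lambda>x. g n x - k x) (\<lambda>x. g n x - k x) < \<eta> / 4"
    unfolding L2_approx_def by (meson zero_less_divide_iff zero_less_numeral)
  have "L2_inner M (\<lambda>x. (f x - g n x) + (g n x - k x)) (\<lambda>x. (f x - g n x) + (g n x - k x)) < \<eta>"
    using L2_inner_self_add_le[OF L2_space_diff[OF fL2 g(1)] L2_space_diff[OF g(1) R_in_L2[OF k(1)]], of n n] n k(2)
    by linarith
  then show "\<exists>k\<in>R. L2_inner M (\<lambda>x. f x - k x) (\<lambda>x. f x - k x) < \<eta>"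
    using k(1) by (intro bexI[of _ k]) simp_all
qed

lemma bounded_in_L2:
  fixes f :: "'a \<Rightarrow> real"
  assumes [measurable]: "f \<in> borel_measurable M" and "\<And>x. \<bar>f x\<bar> \<le> C"
  shows "f \<in> L2_space M"
proof -
  interpret finite_measure M by (rule finite_M)
  have "(f x)\<^sup>2 \<le> C\<^sup>2" for x using power_mono[OF assms(2)[of x], where n = 2] by simp
  then have "integrable M (\<lambda>x. (f x)\<^sup>2)"
    by (intro integrable_const_bound[of _ "C\<^sup>2"]) auto
  then show ?thesis by (simp add: L2_space_def)
qed

text \<open>Stone-Weierstrass approximates \<open>f\<close> uniformly on the compact set
  \<open>S\<close>, and the complement of \<open>S\<close> does not contribute to the integral.
  Boundedness of \<open>f\<close> on the whole space, with the finiteness of \<open>M\<close>, puts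
  \<open>f\<close> into \<open>L2_space M\<close>.\<close>

lemma approx_continuous:
  assumes "continuous_on UNIV f" "\<And>x. \<bar>f x\<bar> \<le> C"
  shows "L2_approx M R f"
  unfolding L2_approx_def
proof (intro allI impI)
  fix \<eta> :: real assume \<eta>: "\<eta> > 0"
  interpret finite_measure M by (rule finite_M)
  have m: "f \<in> borel_measurable M" by (intro measurable_M borel_measurable_continuous_onI assms)
  define m where "m = measure M (space M)"
  \<comment> \<open>Chosen so that
    \<open>\<delta>\<^sup>2 * m = \<eta> * (m / (1 + m)) < \<eta>\<close>, also when the total mass
    \<open>m\<close> is 0.\<close>
  define \<delta> where "\<delta> = sqrt (\<eta> / (1 + m))"
  have "1 + m > 0" by (simp add: m_def add_pos_nonneg)
  then have \<delta>: "\<delta> > 0" using \<eta> by (simp add: \<delta>_def)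
  obtain g where g: "g \<in> R" "\<And>x. x \<in> S \<Longrightarrow> \<bar>f x - g x\<bar> < \<delta>"
    using function_ring_on.Stone_Weierstrass_basic[OF ring continuous_on_subset[OF assms(1) subset_UNIV] \<delta>]
    by auto
  have "(\<integral>x. (f x - g x)\<^sup>2 \<partial>M)
      \<le> (\<integral>x. \<delta>\<^sup>2 \<partial>M)"
  proof (rule integral_mono_AE)
    show "integrable M (\<lambda>x. (f x - g x)\<^sup>2)"
      using L2_space_diff[OF bounded_in_L2[OF m assms(2)] R_in_L2[OF g(1)]] by (simp add: L2_space_def)
    show "AE x in M. (f x - g x)\<^sup>2 \<le> \<delta>\<^sup>2"
      using supp
    proof eventually_elim
      case (elim x)
      have "\<bar>f x - g x\<bar> \<le> \<delta>" using g(2)[OF elim] by simp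
      from power_mono[OF this, of 2] show ?case by simp
    qed
  qed simp
  also have "\<dots> = \<eta> * (m / (1 + m))" using \<open>1 + m > 0\<close> \<eta>
      by (simp add: \<delta>_def m_def)
  also have "\<dots> < \<eta>" using \<open>1 + m > 0\<close> \<eta> by (simp add: field_simps)
  finally show "\<exists>g\<in>R. L2_inner M (\<lambda>x. f x - g x) (\<lambda>x. f x - g x) < \<eta>"
    using g(1) by (auto simp: L2_inner_def power2_eq_square)
qed

lemma approx_zero: "L2_approx M R (\<lambda>_. 0)"
  by (rule approx_continuous[of _ 0]) auto

text \<open>The continuous functions \<open>max 0 (1 - n * infdist x C)\<close> are 1 on
  \<open>C\<close> and vanish eventually at each point off \<open>C\<close>, because such a point
  has positive distance from a closed set. The empty set is treated apart since
  \<open>infdist x {}\<close> is 0 by convention.\<close>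

lemma approx_indicator_closed:
  assumes "closed C"
  shows "L2_approx M R (indicator C)"
proof (cases "C = {}")
  case True
  then have "indicator C = (\<lambda>_. 0 :: real)" by auto
  then show ?thesis using approx_zero by simp
next
  case False
  define g where "g n x = max 0 (1 - real n * infdist x C)" for n x
  have cont: "continuous_on UNIV (g n)" for n
    unfolding g_def by (intro continuous_intros)
  have bd: "\<bar>g n x\<bar> \<le> 1" for n x
    using infdist_nonneg[of x C] by (auto simp: g_def)
  show ?thesis
  proof (rule approx_limit)
    show "indicator C \<in> borel_measurable M" using assms by (intro measurable_M) auto
    show "g n \<in> L2_space M" for n
      by (rule bounded_in_L2[OF measurable_M[OF borel_measurable_continuous_onI[OF cont]] bd])
    show "L2_approx M R (g n)" for n
      by (rule approx_continuous[OF cont bd])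
    show "(\<lambda>_. 1) \<in> L2_space M" by (rule bounded_in_L2[of _ 1]) auto
    show "\<bar>g n x\<bar> \<le> 1" for n x by (rule bd)
    show "(\<lambda>n. g n x) \<longlonglongrightarrow> indicator C x" for x
    proof (cases "x \<in> C")
      case True
      then show ?thesis by (simp add: g_def)
    next
      case x: False
      then have d: "infdist x C > 0"
        using assms False infdist_pos_not_in_closed by blast
      obtain N where N: "real N * infdist x C > 1" using reals_Archimedean3[OF d] by blast
      have "g n x = 0" if "n \<ge> N" for n
      proof -
        have "real N * infdist x C \<le> real n * infdist x C" using that d
            by (intro mult_right_mono) auto
        then show ?thesis using N by (simp add: g_def)
      qed
      then have "\<forall>\<^sub>F n in sequentially. g n x = 0" by (auto simp: eventually_sequentially)
      then show ?thesis using x by (simp add: tendsto_eventually)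
    qed
  qed
qed

lemma indicator_in_L2: "A \<in> sets M \<Longrightarrow> indicator A \<in> L2_space M"
  by (rule bounded_in_L2[of _ 1]) (auto simp: indicator_def)

text \<open>Dynkin's theorem: the closed sets generate the Borel sets and are stable under
  intersection, so it suffices to pass to complements and to countable disjoint unions.\<close>

lemma approx_indicator:
  assumes "A \<in> sets M"
  shows "L2_approx M R (indicator A)"
proof -
  have *: "sets M = sigma_sets UNIV (Collect closed)"
    unfolding sets_M borel_eq_closed by (rule sets_measure_of) auto
  have one: "(\<lambda>_. 1) \<in> L2_space M" "L2_approx M R (\<lambda>_. 1)"
    by (auto intro!: bounded_in_L2[of _ 1] approx_continuous[of _ 1])
  have "Int_stable (Collect (closed :: 'a set \<Rightarrow> bool))" by (auto simp: Int_stable_def)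
  moreover have "Collect closed \<subseteq> Pow (UNIV :: 'a set)" by simp
  ultimately show ?thesis using assms[unfolded *]
  proof (induction rule: sigma_sets_induct_disjoint)
    case (basic A)
    then show ?case by (auto intro: approx_indicator_closed)
  next
    case empty
    have "indicator {} = (\<lambda>_. 0 :: real)" by auto
    then show ?case using approx_zero by simp
  next
    case (compl A)
    then have "A \<in> sets M" by (simp add: *)
    then have "L2_approx M R (\<lambda>x. 1 + (- 1) * indicator A x)"
      using compl one by (intro approx_add approx_scale L2_space_scale indicator_in_L2)
    moreover have "(\<lambda>x. 1 + (- 1) * indicator A x)
        = (indicator (UNIV - A) :: 'a \<Rightarrow> real)"
      by (auto simp: indicator_def)
    ultimately show ?case by simp
  next
    case (union A)
    then have A: "A n \<in> sets M" for n by (auto simp: *)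
    \<comment> \<open>Disjointness turns finite unions into sums, to which \<open>approx_add\<close>
      applies; the countable union is then a limit dominated by 1.\<close>
    have ind: "(indicator (\<Union>i<n. A i) :: 'a \<Rightarrow> real)
        = (\<lambda>x. \<Sum>i<n. indicator (A i) x)" for n
      using union(1) by (intro ext indicator_UN_disjoint) (auto intro: disjoint_family_on_mono)
    have fin: "L2_approx M R (indicator (\<Union>i<n. A i))" for n
    proof (induction n)
      case 0
      have "indicator {} = (\<lambda>_. 0 :: real)" by auto
      then show ?case using approx_zero by simp
    next
      case (Suc n)
      have "L2_approx M R (\<lambda>x. indicator (\<Union>i<n. A i) x + indicator (A n) x)"
        using A by (intro approx_add Suc union indicator_in_L2) auto
      then show ?case unfolding ind by simp
    qed
    show ?case
    proof (rule approx_limit[OF _ _ fin])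
      show "indicator (\<Union> (range A)) \<in> borel_measurable M" using A by auto
      show "indicator (\<Union>i<n. A i) \<in> L2_space M" for n using A by (intro indicator_in_L2) auto
      show "(\<lambda>n. indicator (\<Union>i<n. A i) x) \<longlonglongrightarrow> (indicator (\<Union> (range A)) x :: real)" for x
        by (rule LIMSEQ_indicator_UN)
      show "(\<lambda>_. 1) \<in> L2_space M" by (rule one)
    qed (auto simp: indicator_def)
  qed
qed

text \<open>Simple functions converge pointwise to \<open>f\<close> with
  \<open>2 * \<bar>f x\<bar>\<close> as a square integrable majorant, and they are linear
  combinations of indicators.\<close>

theorem approx:
  assumes "f \<in> L2_space M"
  shows "L2_approx M R f"
proof -
  from assms have [measurable]: "f \<in> borel_measurable M" by (simp add: L2_space_def)
  obtain s where s: "\<And>i. simple_function M (s i)" "\<And>x. x \<in> space M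
      \<Longrightarrow> (\<lambda>i. s i x) \<longlonglongrightarrow> f x"
    "\<And>i x. x \<in> space M \<Longrightarrow> \<bar>s i x\<bar> \<le> 2 * \<bar>f x\<bar>"
    using borel_measurable_implies_sequence_metric[of f M 0] by (simp add: dist_real_def) blast
  have simple: "s i \<in> L2_space M \<and> L2_approx M R (s i)" for i
  proof -
    interpret finite_measure M by (rule finite_M)
    have "emeasure M {x \<in> space M. s i x \<noteq> 0} \<noteq> \<infinity>"
      using emeasure_finite by simp
    with s(1)[of i] show ?thesis
    proof (induction rule: integrable_simple_function_induct)
      case (cong f g)
      have "L2_inner M (\<lambda>x. g x - h x) (\<lambda>x. g x - h x)
          = L2_inner M (\<lambda>x. f x - h x) (\<lambda>x. f x - h x)" for h
        unfolding L2_inner_def using cong by (intro Bochner_Integration.integral_cong) auto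
      moreover have "integrable M (\<lambda>x. (g x)\<^sup>2) \<longleftrightarrow> integrable M (\<lambda>x. (f x)\<^sup>2)"
        using cong by (intro Bochner_Integration.integrable_cong) auto
      ultimately show ?case
        using cong by (auto simp: L2_space_def L2_approx_def borel_measurable_simple_function)
    next
      case (indicator A y)
      then show ?case
        using L2_space_scale[OF indicator_in_L2, of A y] approx_scale[OF approx_indicator, of A y]
        by (simp add: mult.commute)
    next
      case (add f g)
      then show ?case using approx_add L2_space_add by blast
    qed
  qed
  show ?thesis
  proof (rule approx_limit[OF _ _ _ s(2)])
    show "(\<lambda>x. (2::real) * \<bar>f x\<bar>) \<in> L2_space M"
      using assms by (auto intro!: L2_space_scale simp: L2_space_def)
  qed (use simple s(3) in auto)
qed

end


section \<open>Orthonormal polynomials\<close>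

text \<open>Each induction step cancels the top coefficient of \<open>q\<close> by a multiple of
  \<open>P (Suc n)\<close>, whose leading coefficient is nonzero.\<close>

lemma poly_expansion:
  fixes P :: "nat \<Rightarrow> real poly"
  assumes "\<And>k. k \<le> n \<Longrightarrow> degree (P k) = k \<and> P k \<noteq> 0" "degree q \<le> n"
  shows "\<exists>c. q = (\<Sum>k\<le>n. smult (c k) (P k))"
  using assms
proof (induction n arbitrary: q)
  case 0
  then obtain a b where ab: "P 0 = [:a:]" "q = [:b:]"
    by (metis degree_eq_zeroE le_zero_eq order_refl)
  with 0(1)[of 0] have "q = smult (b / a) (P 0)" by simp
  then show ?case by (intro exI[of _ "\<lambda>_. b / a"]) simp
next
  case (Suc n)
  define d where "d = coeff q (Suc n) / coeff (P (Suc n)) (Suc n)"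
  have P: "degree (P (Suc n)) = Suc n" "coeff (P (Suc n)) (Suc n) \<noteq> 0"
    using Suc.prems(1)[of "Suc n"] by (metis leading_coeff_0_iff order_refl)+
  have "degree (q - smult d (P (Suc n))) \<le> n"
  proof (rule degree_le, intro allI impI)
    fix i assume "n < i"
    then consider "i = Suc n" | "i > Suc n" by linarith
    then show "coeff (q - smult d (P (Suc n))) i = 0"
      using P Suc.prems(2) by cases (auto simp: d_def coeff_eq_0)
  qed
  then obtain c where c: "q - smult d (P (Suc n)) = (\<Sum>k\<le>n. smult (c k) (P k))"
    using Suc.IH[of "q - smult d (P (Suc n))"] Suc.prems(1) by auto
  have "q = (\<Sum>k\<le>Suc n. smult ((c(Suc n := d)) k) (P k))"
    using c by (simp add: algebra_simps)
  then show ?case by blast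
qed

text \<open>\<open>J\<close> abstracts integration against a weight, so that
  \<open>J (p * q)\<close> is an inner product on polynomials. Orthogonalisation then becomes pure
  algebra in the polynomial ring.\<close>

locale positive_poly_functional =
  fixes J :: "real poly \<Rightarrow> real"
  assumes add: "J (p + q) = J p + J q" and smult: "J (smult c p) = c * J p"
    and pos: "p \<noteq> 0 \<Longrightarrow> J (p * p) > 0"
begin

lemma sum: "J (\<Sum>i\<in>I. f i) = (\<Sum>i\<in>I. J (f i))"
proof (induction I rule: infinite_finite_induct)
  case empty
  show ?case using smult[of 0 0] by simp
next
  case (infinite I)
  then show ?case using smult[of 0 0] by simp
qed (simp add: add)

lemma diff: "J (p - q) = J p - J q"
  using add[of "p - q" q] by simp

text \<open>Orthogonality is asked against all polynomials of lower degree, not against the other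
  members of a sequence. Existence and uniqueness can thus be settled for each degree
  separately.\<close>

definition ortho :: "nat \<Rightarrow> real poly \<Rightarrow> bool" where
  "ortho n p \<longleftrightarrow> degree p = n \<and> coeff p n > 0 \<and> J (p * p) = 1 \<and>
    (\<forall>q. degree q < n \<longrightarrow> J (p * q) = 0)"

lemma ortho_orthogonal:
  assumes "ortho j p" "ortho k p'" "j \<noteq> k"
  shows "J (p * p') = 0"
  using assms by (metis ortho_def mult.commute linorder_neqE_nat)

text \<open>The polynomials \<open>P 0, ..., P (n - 1)\<close> span all polynomials of degree below
  \<open>n\<close>.\<close>

lemma ortho_lower:
  assumes P: "\<And>k. k < n \<Longrightarrow> degree (P k) = k \<and> P k \<noteq> 0"
    and m: "\<And>k. k < n \<Longrightarrow> J (m * P k) = 0" and q: "degree q < n"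
  shows "J (m * q) = 0"
proof -
  from q obtain n' where n': "n = Suc n'" by (cases n) auto
  obtain c where c: "q = (\<Sum>k\<le>n'. smult (c k) (P k))"
    using poly_expansion[of n' P q] P q n' by auto
  have "J (m * q) = (\<Sum>k\<le>n'. c k * J (m * P k))"
    unfolding c by (simp add: sum_distrib_left sum smult)
  then show ?thesis using m n' by simp
qed

text \<open>Gram-Schmidt: subtract from the monomial of degree \<open>n\<close> its projections onto
  the earlier polynomials, then normalise. The subtracted terms have lower degree, so the leading
  coefficient stays 1, and positivity of \<open>J\<close> permits the normalisation.\<close>

lemma ortho_exists: "\<exists>p. ortho n p"
proof (induction n rule: less_induct)
  case (less n)
  then obtain P where P: "\<And>k. k < n \<Longrightarrow> ortho k (P k)" by metis
  define x :: "real poly" where "x = monom 1 n"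
  define m where "m = x - (\<Sum>k<n. smult (J (x * P k)) (P k))"
  have mc: "coeff m n = 1"
    using P by (auto simp: m_def x_def coeff_sum coeff_eq_0 ortho_def intro!: sum.neutral)
  have deg: "degree m = n"
  proof (rule antisym)
    show "degree m \<le> n"
      using P unfolding m_def x_def ortho_def
      by (intro degree_diff_le degree_monom_le degree_sum_le) (auto intro: order.trans[OF degree_smult_le] less_imp_le)
    show "n \<le> degree m" using mc by (intro le_degree) simp
  qed
  have PP: "J (P k * P j) = (if k = j then 1 else 0)" if "k < n" "j < n" for k j
    using ortho_orthogonal[OF P[OF that(1)] P[OF that(2)]] P[OF that(2)] by (simp add: ortho_def)
  have mP: "J (m * P j) = 0" if "j < n" for j
  proof -
    have "J (m * P j) = J (x * P j) - (\<Sum>k<n. J (x * P k) * J (P k * P j))"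
      unfolding m_def left_diff_distrib diff sum_distrib_right sum mult_smult_left smult ..
    also have "(\<Sum>k<n. J (x * P k) * J (P k * P j)) = (\<Sum>k<n. if k = j then J (x * P j) else 0)"
      using PP that by (intro sum.cong) auto
    finally show ?thesis using that by simp
  qed
  have low: "J (m * q) = 0" if "degree q < n" for q
  proof (rule ortho_lower[OF _ mP that])
    fix k assume "k < n"
    then show "degree (P k) = k \<and> P k \<noteq> 0" using P[of k] by (auto simp: ortho_def)
  qed
  define c where "c = 1 / sqrt (J (m * m))"
  have "m \<noteq> 0" using mc by auto
  then have J: "J (m * m) > 0" by (rule pos)
  then have "c > 0" by (simp add: c_def)
  have "c * (c * J (m * m)) = J (m * m) / (sqrt (J (m * m)) * sqrt (J (m * m)))"
    unfolding c_def by (simp only: times_divide_eq_left times_divide_eq_right mult_1_left divide_divide_eq_left)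
  then have "c * (c * J (m * m)) = 1"
    using J by simp
  then have "ortho n (smult c m)"
    using \<open>c > 0\<close> deg mc low by (simp add: ortho_def smult)
  then show ?case by blast
qed

text \<open>Removing the leading term of \<open>p'\<close> by a multiple of \<open>p\<close> leaves
  a \<open>d\<close> of lower degree, or 0. A nonzero \<open>d\<close> would be orthogonal to
  \<open>p\<close> and \<open>p'\<close>, hence to itself, contradicting positivity. So
  \<open>p' = smult c p\<close>, and normalisation with positive leading coefficients forces
  \<open>c = 1\<close>.\<close>

lemma ortho_unique:
  assumes p: "ortho n p" and p': "ortho n p'"
  shows "p = p'"
proof -
  define c where "c = coeff p' n / coeff p n"
  have c: "c > 0" using p p' by (simp add: c_def ortho_def)
  define d where "d = p' - smult c p"
  have dp: "coeff d n = 0" "degree d \<le> n"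
    using p p' unfolding d_def c_def ortho_def
    by (auto intro!: degree_diff_le order.trans[OF degree_smult_le])
  have "d = 0"
  proof (rule ccontr)
    assume d: "d \<noteq> 0"
    then have "degree d < n" using dp by (metis leading_coeff_0_iff order_neq_le_trans)
    then have "J (p' * d) = 0" "J (p * d) = 0" using p p' by (auto simp: ortho_def)
    then have "J (d * d) = 0"
      by (subst (1) d_def) (simp add: left_diff_distrib diff smult)
    then show False using pos[OF d] by simp
  qed
  then have "p' = smult c p" by (simp add: d_def)
  moreover from this have "c * c = 1" using p p' by (simp add: ortho_def smult)
  then have "c = 1" using c
      by (metis abs_of_pos abs_mult_self_eq mult_cancel_left1 real_sqrt_abs2 real_sqrt_one)
  ultimately show ?thesis by simp
qed

lemma orthonormal_iff:
  "(\<forall>k. degree (P k) = k \<and> lead_coeff (P k) > 0) \<and> (\<forall>j k. J (P j * P k)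
      = (if j = k then 1 else 0))
     \<longleftrightarrow> (\<forall>n. ortho n (P n))" (is "?L \<longleftrightarrow> ?R")
proof
  assume L: ?L
  have deg: "degree (P k) = k" for k
    using L by blast
  have lead: "coeff (P k) k > 0" for k
  proof -
    have "lead_coeff (P k) > 0" using L by blast
    then show ?thesis by (simp only: deg)
  qed
  have on: "J (P j * P k) = (if j = k then 1 else 0)" for j k
    using L by blast
  have nz: "P k \<noteq> 0" for k
    using lead[of k] by auto
  have low: "J (P n * q) = 0" if "degree q < n" for n q
    by (rule ortho_lower[OF _ _ that, of P]) (simp_all add: deg nz on)
  show ?R
    unfolding ortho_def using deg lead on low by simp
next
  assume R: ?R
  have on: "J (P j * P k) = (if j = k then 1 else 0)" for j k
    using R ortho_orthogonal[of j "P j" k "P k"] by (simp add: ortho_def)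
  have deg: "degree (P k) = k \<and> lead_coeff (P k) > 0" for k
    using R[THEN spec, of k] by (simp add: ortho_def)
  show ?L
    using on deg by blast
qed

text \<open>This justifies the definite description in \<open>jacobi_poly\<close>.\<close>

lemma orthonormal_ex1:
  "\<exists>!P. (\<forall>k. degree (P k) = k \<and> lead_coeff (P k) > 0) \<and>
    (\<forall>j k. J (P j * P k) = (if j = k then 1 else 0))"
  unfolding orthonormal_iff
proof (rule ex_ex1I)
  show "\<exists>P. \<forall>n. ortho n (P n)" using ortho_exists by metis
qed (auto intro: ortho_unique)

end

section \<open>Jacobi polynomials\<close>

abbreviation jacobi_density1 :: "real \<Rightarrow> real \<Rightarrow> real \<Rightarrow> real" where
  "jacobi_density1 \<alpha> \<beta> t \<equiv> indicator {-1..1} t * jacobi_weight1 \<alpha> \<beta> t"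

lemma jacobi_density1_nonneg: "0 \<le> jacobi_density1 \<alpha> \<beta> t"
  by (simp add: jacobi_weight1_def)

lemma jacobi_density1_measurable [measurable]:
    "jacobi_density1 \<alpha> \<beta> \<in> borel_measurable borel"
  unfolding jacobi_weight1_def by measurable

text \<open>The substitution \<open>u = (1 + t) / 2\<close> maps \<open>[-1, 1]\<close> onto
  \<open>[0, 1]\<close> and the weight to a Beta integrand with parameters
  \<open>\<beta> + 1\<close> and \<open>\<alpha> + 1\<close>, which are positive. The halves in both
  factors account for the constant \<open>2 powr (\<alpha> + \<beta>)\<close>.\<close>

lemma integrable_jacobi_density1:
  assumes "\<alpha> > -1" "\<beta> > -1"
  shows "integrable lborel (jacobi_density1 \<alpha> \<beta>)"
proof -
  define f :: "real \<Rightarrow> real" where "f t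
      = indicator {0..1} t * (t powr \<beta> * (1 - t) powr \<alpha>)" for t
  have "integrable lborel f"
    using integrable_Beta[of "\<beta> + 1" "\<alpha> + 1"] assms
        by (simp add: set_integrable_def f_def[abs_def])
  then have "integrable lborel (\<lambda>t. f (1 / 2 + (1 / 2) * t))"
    by (rule lborel_integrable_real_affine) simp
  then have "integrable lborel (\<lambda>t. 2 powr (\<alpha> + \<beta>) * f (1 / 2 + (1 / 2) * t))"
    by simp
  also have "(\<lambda>t. 2 powr (\<alpha> + \<beta>) * f (1 / 2 + (1 / 2) * t))
      = jacobi_density1 \<alpha> \<beta>"
  proof
    fix t
    show "2 powr (\<alpha> + \<beta>) * f (1 / 2 + (1 / 2) * t) = jacobi_density1 \<alpha> \<beta> t"
    proof (cases "t \<in> {-1..1}")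
      case True
      have *: "1 / 2 + (1 / 2) * t = (1 + t) / 2" "1 - (1 + t) / 2 = (1 - t) / 2"
          by (auto simp: field_simps)
      show ?thesis
        using True unfolding f_def * jacobi_weight1_def
        by (simp add: powr_divide powr_add)
    qed (auto simp: f_def)
  qed
  finally show ?thesis .
qed

lemma integrable_jacobi_density1_poly:
  assumes "\<alpha> > -1" "\<beta> > -1"
  shows "integrable lborel (\<lambda>t. jacobi_density1 \<alpha> \<beta> t * poly p t)"
proof -
  have "compact (poly p ` {-1..1})"
    by (intro compact_continuous_image continuous_intros) auto
  then obtain C where C: "\<And>t. t \<in> {-1..1} \<Longrightarrow> \<bar>poly p t\<bar> \<le> C"
    using compact_imp_bounded[of "poly p ` {-1..1}"] by (force simp: bounded_iff)
  show ?thesis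
  proof (rule Bochner_Integration.integrable_bound)
    show "integrable lborel (\<lambda>t. jacobi_density1 \<alpha> \<beta> t * C)"
      using integrable_jacobi_density1[OF assms] by simp
    have "norm (jacobi_density1 \<alpha> \<beta> t * poly p t)
        \<le> norm (jacobi_density1 \<alpha> \<beta> t * C)" for t
      using C[of t] by (auto simp: indicator_def abs_mult intro!: mult_left_mono)
    then show "AE t in lborel. norm (jacobi_density1 \<alpha> \<beta> t * poly p t)
        \<le> norm (jacobi_density1 \<alpha> \<beta> t * C)"
      by simp
  qed (measurable, auto intro!: borel_measurable_continuous_onI continuous_intros)
qed

definition jacobi_functional :: "real \<Rightarrow> real \<Rightarrow> real poly \<Rightarrow> real" where
  "jacobi_functional \<alpha> \<beta> p
      = (\<integral>t. jacobi_density1 \<alpha> \<beta> t * poly p t \<partial>lborel)"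

lemma poly_borel_measurable [measurable]: "poly (p :: real poly) \<in> borel_measurable borel"
  by (intro borel_measurable_continuous_onI continuous_intros)

lemma L2_inner_jacobi_measure1:
  "L2_inner (jacobi_measure1 \<alpha> \<beta>) (poly p) (poly q)
      = jacobi_functional \<alpha> \<beta> (p * q)"
  unfolding L2_inner_def jacobi_measure1_def jacobi_functional_def
  by (subst integral_density) (auto simp: jacobi_density1_nonneg)

text \<open>For positivity: the weight is positive on the open interval and a nonzero
  \<open>p\<close> has finitely many roots, so a vanishing integral of the weighted square would
  make the interval a null set.\<close>

lemma positive_poly_functional_jacobi:
  assumes "\<alpha> > -1" "\<beta> > -1"
  shows "positive_poly_functional (jacobi_functional \<alpha> \<beta>)"
proof
  note int = integrable_jacobi_density1_poly[OF assms]
  show "jacobi_functional \<alpha> \<beta> (p + q)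
      = jacobi_functional \<alpha> \<beta> p + jacobi_functional \<alpha> \<beta> q" for p q
    unfolding jacobi_functional_def by (simp add: distrib_left int)
  show "jacobi_functional \<alpha> \<beta> (smult c p)
      = c * jacobi_functional \<alpha> \<beta> p" for c p
    unfolding jacobi_functional_def by (simp add: mult.left_commute)
  fix p :: "real poly" assume p: "p \<noteq> 0"
  let ?f = "\<lambda>t. jacobi_density1 \<alpha> \<beta> t * poly (p * p) t"
  have nonneg: "0 \<le> ?f t" for t by (simp add: jacobi_density1_nonneg)
  have "integral\<^sup>L lborel ?f \<noteq> 0"
  proof
    assume "integral\<^sup>L lborel ?f = 0"
    then have "AE t in lborel. ?f t = 0"
      using integral_nonneg_eq_0_iff_AE[OF int[of "p * p"]] nonneg by blast
    then have "AE t in lborel. t \<notin> {-1<..<1} \<or> poly p t = 0"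
      by eventually_elim (auto simp: jacobi_weight1_def)
    moreover have "AE t in lborel. poly p t \<noteq> 0"
      using AE_not_in[OF finite_imp_null_set_lborel[OF poly_roots_finite[OF p]]] by simp
    ultimately have "AE t in lborel. t \<notin> {-1<..<1::real}" by eventually_elim auto
    then have "{-1<..<1::real} \<in> null_sets lborel"
      by (simp add: AE_iff_null_sets)
    then show False by (simp add: null_sets_def)
  qed
  moreover have "integral\<^sup>L lborel ?f \<ge> 0" using nonneg by (intro integral_nonneg_AE) auto
  ultimately show "jacobi_functional \<alpha> \<beta> (p * p) > 0" by (simp add: jacobi_functional_def)
qed

lemma
  assumes "\<alpha> > -1" "\<beta> > -1"
  shows degree_jacobi_poly: "degree (jacobi_poly \<alpha> \<beta> k) = k"
    and jacobi_poly_nonzero: "jacobi_poly \<alpha> \<beta> k \<noteq> 0"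

    and orthonormal_jacobi_poly: "jacobi_functional \<alpha> \<beta> (jacobi_poly \<alpha> \<beta> j * jacobi_poly \<alpha> \<beta> k) = (if j = k then 1 else 0)"
proof -
  interpret positive_poly_functional "jacobi_functional \<alpha> \<beta>"
      by (rule positive_poly_functional_jacobi[OF assms])
  \<comment> \<open>Folding rewrites the functional as the inner product, so that the description
    becomes literally the body of \<open>jacobi_poly\<close>.\<close>
  note * = theI'[OF orthonormal_ex1, folded L2_inner_jacobi_measure1, folded jacobi_poly_def]
  show "degree (jacobi_poly \<alpha> \<beta> k) = k" "jacobi_poly \<alpha> \<beta> k \<noteq> 0"
    "jacobi_functional \<alpha> \<beta> (jacobi_poly \<alpha> \<beta> j * jacobi_poly \<alpha> \<beta> k) = (if j = k then 1 else 0)"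
    using * by (simp_all add: L2_inner_jacobi_measure1, metis coeff_0 less_irrefl)
qed

section \<open>Tensor products\<close>

text \<open>Fubini for products of one-variable functions. Lebesgue measure on
  \<open>real ^ 's\<close> is by \<open>lborel_eq\<close> an image of the product measure indexed by
  \<open>Basis\<close>, so the coordinates have to be matched with the axis vectors.\<close>

lemma
  fixes h :: "'s::finite \<Rightarrow> real \<Rightarrow> real"
  assumes int: "\<And>j. integrable lborel (h j)"
  shows integrable_lborel_prod: "integrable lborel (\<lambda>x::real^'s. \<Prod>j\<in>UNIV. h j (x $ j))"

    and integral_lborel_prod: "(\<integral>x. (\<Prod>j\<in>UNIV. h j (x $ j)) \<partial>(lborel :: (real^'s) measure)) = (\<Prod>j\<in>UNIV. \<integral>t. h j t \<partial>lborel)"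
proof -
  interpret product_sigma_finite "\<lambda>_::real^'s. lborel :: real measure" by standard
  let ?ax = "\<lambda>j::'s. axis j (1::real)"
  let ?T = "\<lambda>f. \<Sum>b\<in>(Basis::(real^'s) set). f b *\<^sub>R b"
  \<comment> \<open>The family \<open>h\<close> relabelled by basis vectors instead of
    coordinates.\<close>
  define H where "H b = h (the_inv ?ax b)" for b
  have inj: "inj ?ax" by (auto simp: inj_on_def axis_eq_axis)
  have Basis: "(Basis::(real^'s) set) = range ?ax" by (auto simp: Basis_vec_def)
  have H: "H (?ax j) = h j" for j by (simp add: H_def the_inv_f_f[OF inj])
  have reindex: "(\<Prod>b\<in>Basis. F b) = (\<Prod>j\<in>UNIV. F (?ax j))" for F :: "real^'s \<Rightarrow> real"
    unfolding Basis using inj by (subst prod.reindex) auto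
  have nth: "?T f $ j = f (?ax j)" for f j
  proof -
    have "?T f $ j = ?T f \<bullet> ?ax j" by (simp add: inner_axis)
    also have "\<dots> = f (?ax j)" by (rule inner_sum_left_Basis) (auto simp: Basis)
    finally show ?thesis .
  qed
  have prod: "(\<Prod>j\<in>UNIV. h j (?T f $ j)) = (\<Prod>b\<in>Basis. H b (f b))" for f
    unfolding reindex nth H ..
  have [measurable]: "h j \<in> borel_measurable borel" for j
      using borel_measurable_integrable[OF int[of j]] by simp
  have intH: "integrable lborel (H b)" for b unfolding H_def by (rule int)
  have T: "?T \<in> measurable (\<Pi>\<^sub>M b\<in>Basis. lborel) borel" by measurable
  have m: "(\<lambda>x::real^'s. \<Prod>j\<in>UNIV. h j (x $ j)) \<in> borel_measurable borel" by measurable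
  show "integrable lborel (\<lambda>x::real^'s. \<Prod>j\<in>UNIV. h j (x $ j))"
    unfolding lborel_eq[where 'a="real^'s"]
    by (subst integrable_distr_eq[OF T m]) (simp only: prod, intro product_integrable_prod finite_Basis intH)
  show "(\<integral>x. (\<Prod>j\<in>UNIV. h j (x $ j)) \<partial>(lborel :: (real^'s) measure))
      = (\<Prod>j\<in>UNIV. \<integral>t. h j t \<partial>lborel)"
    unfolding lborel_eq[where 'a="real^'s"]
    by (subst integral_distr[OF T m]) (simp only: prod, subst product_integral_prod, auto
        simp: intH reindex H)
qed

section \<open>The weighted measure on the cube and tensor products of polynomials\<close>

lemma jacobi_density_eq:
  "indicator unit_cube x * jacobi_weight \<alpha> \<beta> x
      = (\<Prod>j\<in>UNIV. jacobi_density1 \<alpha> \<beta> (x $ j))"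
proof (cases "x \<in> unit_cube")
  case True
  then show ?thesis by (auto simp: unit_cube_def jacobi_weight_def jacobi_weight1_def intro!: prod.cong)
next
  case False
  then obtain j where "x $ j \<notin> {-1..1}" by (auto simp: unit_cube_def)
  then have "(\<Prod>j\<in>UNIV. jacobi_density1 \<alpha> \<beta> (x $ j)) = 0"
    by (intro prod_zero bexI[of _ j]) auto
  with False show ?thesis by simp
qed

text \<open>Arbitrary factors are allowed because, unlike the Jacobi tensors, this class is closed
  under multiplication and contains the constant 1 and the coordinate functions.\<close>

definition poly_tensor :: "('s::finite \<Rightarrow> real poly) \<Rightarrow> real ^ 's \<Rightarrow> real" where
  "poly_tensor p x = (\<Prod>j\<in>UNIV. poly (p j) (x $ j))"

lemma jacobi_tensor_eq:
    "jacobi_tensor \<alpha> \<beta> k = poly_tensor (\<lambda>j. jacobi_poly \<alpha> \<beta> (k $ j))"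
  by (simp add: fun_eq_iff jacobi_tensor_def poly_tensor_def)

lemma poly_tensor_mult: "poly_tensor p x * poly_tensor q x = poly_tensor (\<lambda>j. p j * q j) x"
  by (simp add: poly_tensor_def prod.distrib)

lemma continuous_poly_tensor: "continuous_on A (poly_tensor p)"
  unfolding poly_tensor_def by (intro continuous_intros)

lemma poly_tensor_measurable [measurable]: "poly_tensor p \<in> borel_measurable borel"
  by (intro borel_measurable_continuous_onI continuous_poly_tensor)

lemma sets_jacobi_measure [simp, measurable_cong]: "sets (jacobi_measure \<alpha> \<beta>) = sets borel"
  by (simp add: jacobi_measure_def)

lemma
  fixes p :: "'s::finite \<Rightarrow> real poly"
  assumes "\<alpha> > -1" "\<beta> > -1"
  shows integrable_poly_tensor: "integrable (jacobi_measure \<alpha> \<beta>) (poly_tensor p)"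

    and integral_poly_tensor: "(\<integral>x. poly_tensor p x \<partial>jacobi_measure \<alpha> \<beta>) = (\<Prod>j\<in>UNIV. jacobi_functional \<alpha> \<beta> (p j))"
proof -
  have m: "(\<lambda>x::real^'s. \<Prod>j\<in>UNIV. jacobi_density1 \<alpha> \<beta> (x $ j)) \<in> borel_measurable lborel"
    unfolding jacobi_weight1_def by measurable
  have nonneg: "AE x::real^'s in lborel. 0
      \<le> (\<Prod>j\<in>UNIV. jacobi_density1 \<alpha> \<beta> (x $ j))"
    by (intro AE_I2 prod_nonneg jacobi_density1_nonneg)
  have eq: "(\<Prod>j\<in>UNIV. jacobi_density1 \<alpha> \<beta> (x $ j)) *\<^sub>R poly_tensor p x
      = (\<Prod>j\<in>UNIV. jacobi_density1 \<alpha> \<beta> (x $ j) * poly (p j) (x $ j))" for x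
    by (simp add: poly_tensor_def prod.distrib)
  note int = integrable_jacobi_density1_poly[OF assms]
  show "integrable (jacobi_measure \<alpha> \<beta>) (poly_tensor p)"
    unfolding jacobi_measure_def jacobi_density_eq
    by (subst integrable_density[OF _ m nonneg]) (measurable, unfold eq, intro integrable_lborel_prod int)
  show "(\<integral>x. poly_tensor p x \<partial>jacobi_measure \<alpha> \<beta>)
      = (\<Prod>j\<in>UNIV. jacobi_functional \<alpha> \<beta> (p j))"
    unfolding jacobi_measure_def jacobi_density_eq jacobi_functional_def
    by (subst integral_density[OF _ m nonneg]) (measurable, unfold eq, intro integral_lborel_prod int)
qed

lemma poly_tensor_L2:
  assumes "\<alpha> > -1" "\<beta> > -1"
  shows "poly_tensor p \<in> L2_space (jacobi_measure \<alpha> \<beta>)"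
  using integrable_poly_tensor[OF assms, of "\<lambda>j. p j * p j"]
  by (simp add: L2_space_def power2_eq_square poly_tensor_mult)

lemma orthonormal_jacobi_tensor:
  assumes "\<alpha> > -1" "\<beta> > -1"
  shows "L2_inner (jacobi_measure \<alpha> \<beta>) (jacobi_tensor \<alpha> \<beta> k) (jacobi_tensor \<alpha> \<beta> l) = (if k = l then 1 else 0)"
proof -
  have "L2_inner (jacobi_measure \<alpha> \<beta>) (jacobi_tensor \<alpha> \<beta> k) (jacobi_tensor \<alpha> \<beta> l)
      = (\<Prod>j\<in>UNIV. if k $ j = l $ j then 1 else 0)"
    unfolding L2_inner_def jacobi_tensor_eq poly_tensor_mult integral_poly_tensor[OF assms]
    by (simp add: orthonormal_jacobi_poly[OF assms])
  also have "\<dots> = (if k = l then 1 else 0)"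
    by (auto simp: vec_eq_iff)
  finally show ?thesis .
qed

lemma sum_fun_apply: "(\<Sum>i\<in>I. f i) x = (\<Sum>i\<in>I. f i x)"
  by (induction I rule: infinite_finite_induct) (auto simp: zero_fun_def plus_fun_def)

text \<open>Expand every factor in Jacobi polynomials up to the largest occurring degree and
  multiply out.\<close>

lemma poly_tensor_in_span:
  assumes "\<alpha> > -1" "\<beta> > -1"
  shows "poly_tensor p \<in> span (range (jacobi_tensor \<alpha> \<beta>))"
proof -
  define n where "n = Max (range (\<lambda>j. degree (p j)))"
  have "\<exists>c. p j = (\<Sum>k\<le>n. smult (c k) (jacobi_poly \<alpha> \<beta> k))" for j
    using degree_jacobi_poly[OF assms] jacobi_poly_nonzero[OF assms]
    by (intro poly_expansion) (auto simp: n_def)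
  then obtain c where c: "\<And>j. p j = (\<Sum>k\<le>n. smult (c j k) (jacobi_poly \<alpha> \<beta> k))" by metis
  have "poly_tensor p = (\<Sum>g\<in>Pi\<^sub>E UNIV (\<lambda>_. {..n}). (\<Prod>j\<in>UNIV. c j (g j)) *\<^sub>R jacobi_tensor \<alpha> \<beta> (\<chi> j. g j))"
  proof
    fix x
    have "poly_tensor p x
        = (\<Prod>j\<in>UNIV. \<Sum>k\<le>n. c j k * poly (jacobi_poly \<alpha> \<beta> k) (x $ j))"
      by (simp add: poly_tensor_def c poly_sum)
    also have "\<dots> = (\<Sum>g\<in>Pi\<^sub>E UNIV (\<lambda>_. {..n}). \<Prod>j\<in>UNIV. c j (g j) * poly (jacobi_poly \<alpha> \<beta> (g j)) (x $ j))"
      by (rule prod_sum_PiE) auto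
    finally show "poly_tensor p x
        = (\<Sum>g\<in>Pi\<^sub>E UNIV (\<lambda>_. {..n}). (\<Prod>j\<in>UNIV. c j (g j)) *\<^sub>R jacobi_tensor \<alpha> \<beta> (\<chi> j. g j)) x"
      by (simp add: sum_fun_apply scaleR_fun_def prod.distrib jacobi_tensor_def)
  qed
  also have "\<dots> \<in> span (range (jacobi_tensor \<alpha> \<beta>))"
    by (intro span_sum span_scale span_base) auto
  finally show ?thesis .
qed

section \<open>Density of the span of the Jacobi tensors\<close>

lemma compact_unit_cube: "compact (unit_cube :: (real ^ 's::finite) set)"
proof -
  have *: "unit_cube = cbox (\<chi> j. -1) ((\<chi> j. 1) :: real ^ 's)"
    by (auto simp: unit_cube_def mem_box_cart)
  show ?thesis unfolding * by (rule compact_cbox)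
qed

lemma function_ring_jacobi:
  assumes "\<alpha> > -1" "\<beta> > -1"
  shows "function_ring_on (span (range (jacobi_tensor \<alpha> \<beta>))) (unit_cube :: (real ^ 's::finite) set)"
proof
  let ?G = "range (jacobi_tensor \<alpha> \<beta> :: nat ^ 's \<Rightarrow> _)"
  note in_span = poly_tensor_in_span[OF assms]
  show "compact (unit_cube :: (real ^ 's) set)" by (rule compact_unit_cube)
  show "continuous_on unit_cube f" if "f \<in> span ?G" for f
    using that
  proof (induction rule: span_induct)
    case step
    then show ?case by (auto simp: jacobi_tensor_eq continuous_poly_tensor)
  next
    case base
    show ?case
      by (rule subspaceI) (auto simp: zero_fun_def plus_fun_def scaleR_fun_def intro!: continuous_intros)
  qed
  show "(\<lambda>x. f x + g x) \<in> span ?G" if "f \<in> span ?G" "g \<in> span ?G" for f g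
    using span_add[OF that] by (simp add: plus_fun_def)
  \<comment> \<open>Closure under products takes two inductions over the span, one for each factor;
    here the left factor is fixed as a tensor.\<close>
  have mult1: "(\<lambda>x. poly_tensor p x * g x) \<in> span ?G" if "g \<in> span ?G" for p g
    using that
  proof (induction rule: span_induct)
    case (step h)
    then obtain k where "h = jacobi_tensor \<alpha> \<beta> k" by blast
    then have "(\<lambda>x. poly_tensor p x * h x)
        = poly_tensor (\<lambda>j. p j * jacobi_poly \<alpha> \<beta> (k $ j))"
      by (simp add: jacobi_tensor_eq poly_tensor_mult)
    then show ?case using in_span by metis
  next
    case base
    show ?case
    proof (intro subspaceI; unfold mem_Collect_eq)
      show "(\<lambda>x. poly_tensor p x * 0 x) \<in> span ?G" using span_zero[of ?G]
          by (simp add: zero_fun_def)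
      show "(\<lambda>x. poly_tensor p x * (f + g) x) \<in> span ?G"
        if "(\<lambda>x. poly_tensor p x * f x) \<in> span ?G" "(\<lambda>x. poly_tensor p x * g x) \<in> span ?G" for f g
        using span_add[OF that] by (simp add: plus_fun_def distrib_left)
      show "(\<lambda>x. poly_tensor p x * (c *\<^sub>R f) x) \<in> span ?G"
        if "(\<lambda>x. poly_tensor p x * f x) \<in> span ?G" for c f
        using span_scale[OF that, of c] by (simp add: scaleR_fun_def mult.left_commute)
    qed
  qed
  show "(\<lambda>x. f x * g x) \<in> span ?G" if "f \<in> span ?G" "g \<in> span ?G" for f g
    using that(1)
  proof (induction rule: span_induct)
    case (step h)
    then obtain k where "h = poly_tensor (\<lambda>j. jacobi_poly \<alpha> \<beta> (k $ j))"
      using jacobi_tensor_eq by blast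
    then show ?case using mult1[OF that(2)] by blast
  next
    case base
    show ?case
    proof (intro subspaceI; unfold mem_Collect_eq)
      show "(\<lambda>x. 0 x * g x) \<in> span ?G" using span_zero[of ?G] by (simp add: zero_fun_def)
      show "(\<lambda>x. (f + h) x * g x) \<in> span ?G"
        if "(\<lambda>x. f x * g x) \<in> span ?G" "(\<lambda>x. h x * g x) \<in> span ?G" for f h
        using span_add[OF that] by (simp add: plus_fun_def distrib_right)
      show "(\<lambda>x. (c *\<^sub>R f) x * g x) \<in> span ?G"
          if "(\<lambda>x. f x * g x) \<in> span ?G" for c f
        using span_scale[OF that, of c] by (simp add: scaleR_fun_def mult.assoc)
    qed
  qed
  show "(\<lambda>_. c) \<in> span ?G" for c
    using span_scale[OF in_span[of "\<lambda>_. 1"], of c] by (simp add: scaleR_fun_def poly_tensor_def)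
  show "\<exists>f\<in>span ?G. f x \<noteq> f y" if "x \<noteq> y" for x y
  proof -
    from that obtain i where i: "x $ i \<noteq> y $ i" by (auto simp: vec_eq_iff)
    \<comment> \<open>The identity polynomial in slot \<open>i\<close> and 1 elsewhere gives the
      \<open>i\<close>-th coordinate function, which separates the points.\<close>
    have "poly_tensor (\<lambda>j. if j = i then [:0, 1:] else 1) z = z $ i" for z :: "real ^ 's"
      unfolding poly_tensor_def by (simp add: if_distrib if_distribR cong: if_cong)
    then show ?thesis using in_span i by metis
  qed
qed

lemma L2_dense_jacobi:
  assumes "\<alpha> > -1" "\<beta> > -1"
  shows "L2_dense (jacobi_measure \<alpha> \<beta>) (span (range (jacobi_tensor \<alpha> \<beta>))) (unit_cube :: (real ^ 's::finite) set)"
proof (rule L2_dense.intro)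
  let ?M = "jacobi_measure \<alpha> \<beta> :: (real ^ 's) measure"
  show "sets ?M = sets borel" by simp
  \<comment> \<open>The constant 1 is a tensor polynomial; its integrability is the finiteness of
    the measure.\<close>
  have "integrable ?M (\<lambda>_. 1 :: real)"
    using integrable_poly_tensor[OF assms, of "\<lambda>_. 1"] by (simp add: poly_tensor_def[abs_def])
  then have "emeasure ?M (space ?M) < \<infinity>" by (simp add: integrable_iff_bounded)
  then show "finite_measure ?M" by (intro finite_measureI) simp
  have m: "(\<lambda>x::real^'s. \<Prod>j\<in>UNIV. jacobi_density1 \<alpha> \<beta> (x $ j)) \<in> borel_measurable lborel"
    unfolding jacobi_weight1_def by measurable
  show "AE x in ?M. x \<in> unit_cube"
    unfolding jacobi_measure_def
    by (subst AE_density) (use m in \<open>auto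
        simp: jacobi_density_eq[symmetric] split: split_indicator\<close>)
  show "function_ring_on (span (range (jacobi_tensor \<alpha> \<beta>))) (unit_cube :: (real ^ 's) set)"
    by (rule function_ring_jacobi[OF assms])
  show "span (range (jacobi_tensor \<alpha> \<beta>)) \<subseteq> L2_space ?M"
    by (intro span_minimal subspace_L2_space) (auto simp: jacobi_tensor_eq poly_tensor_L2[OF assms])
qed


section \<open>Truncation of the Jacobi expansion\<close>

lemma span_range_lincomb:
  fixes e :: "'k \<Rightarrow> 'a \<Rightarrow> real"
  assumes "g \<in> span (range e)"
  obtains F c where "finite F" "g = (\<lambda>x. \<Sum>k\<in>F. c k * e k x)"
proof -
  from assms obtain t u where t: "finite t" "t \<subseteq> range e" "g = (\<Sum>a\<in>t. u a *\<^sub>R a)"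
    unfolding span_explicit by blast
  \<comment> \<open>\<open>e\<close> may repeat values, so indices are chosen on which it is
    injective.\<close>
  then obtain F where F: "inj_on e F" "t = e ` F" by (meson subset_image_inj)
  have "finite F" using t(1) F finite_imageD by blast
  moreover have "g = (\<lambda>x. \<Sum>k\<in>F. u (e k) * e k x)"
    using F unfolding t(3) by (auto simp: fun_eq_iff sum_fun_apply scaleR_fun_def sum.reindex)
  ultimately show ?thesis by (rule that)
qed

lemma finite_span_dim_at_most:
  assumes "finite A"
  shows "dim_at_most (span A) (card A)"
proof -
  obtain B where B: "B \<subseteq> A" "independent B" "A \<subseteq> span B"
    by (rule maximal_independent_subset)
  have "span B = span A"
    using B span_mono[OF B(1)] span_minimal[OF B(3) subspace_span] by blast
  moreover have "finite B" "card B \<le> card A"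
    using assms B(1) by (auto intro: finite_subset card_mono)
  ultimately show ?thesis unfolding dim_at_most_def using B(2) by blast
qed

text \<open>Parseval is used only up to an arbitrary \<open>\<eta>\<close>: density supplies a
  finite set of indices that captures the squared norm of \<open>f\<close> up to
  \<open>\<eta>\<close>, and the indices outside \<open>K\<close> contribute at most
  \<open>\<epsilon>\<^sup>2\<close> by the assumption on \<open>K\<close> and the bound on the
  \<open>K\<close>-norm.\<close>

lemma L2_norm_jacobi_truncation:
  fixes f :: "real ^ 's \<Rightarrow> real"
  assumes "\<alpha> > -1" "\<beta> > -1"
    and f: "f \<in> U_ball \<alpha> \<beta> r a" and "finite K" and "\<epsilon> > 0"
    and K: "\<And>k. k \<notin> K
        \<Longrightarrow> 1 \<le> \<epsilon>\<^sup>2 * lambda_a a k powr (2 * r)"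
  shows "L2_norm (jacobi_measure \<alpha> \<beta>) (f - (\<Sum>k\<in>K. jacobi_coeff \<alpha> \<beta> f k *\<^sub>R jacobi_tensor \<alpha> \<beta> k)) \<le> \<epsilon>"
proof -
  let ?M = "jacobi_measure \<alpha> \<beta> :: (real ^ 's) measure"
  let ?e = "jacobi_tensor \<alpha> \<beta> :: nat ^ 's \<Rightarrow> _"
  let ?f = "jacobi_coeff \<alpha> \<beta> f"
  let ?D = "\<lambda>x. f x - (\<Sum>k\<in>K. ?f k * ?e k x)"
  note \<alpha>\<beta> = assms(1,2)
  have fL2: "f \<in> L2_space ?M"
    and summ: "(\<lambda>k. lambda_a a k powr (2 * r) * \<bar>?f k\<bar>\<^sup>2) summable_on UNIV"
    and le1: "(\<Sum>\<^sub>\<infinity>k. lambda_a a k powr (2 * r) * \<bar>?f k\<bar>\<^sup>2) \<le> 1"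
    using f by (auto simp: U_ball_def K_space_def K_norm_def)
  have eL2: "?e k \<in> L2_space ?M" for k
      by (simp add: jacobi_tensor_eq poly_tensor_L2[OF \<alpha>\<beta>])
  have dist: "L2_inner ?M (\<lambda>x. f x - (\<Sum>k\<in>I. c k * ?e k x)) (\<lambda>x. f x - (\<Sum>k\<in>I. c k * ?e k x))
    = L2_inner ?M f f - (\<Sum>k\<in>I. (?f k)\<^sup>2) + (\<Sum>k\<in>I. (?f k - c k)\<^sup>2)"
        if "finite I" for I c
    unfolding jacobi_coeff_def
    by (rule L2_dist_orthonormal_lincomb[OF that fL2 eL2]) (rule orthonormal_jacobi_tensor[OF \<alpha>\<beta>])
  have "L2_inner ?M ?D ?D \<le> \<epsilon>\<^sup>2 + \<eta>" if "\<eta> > 0" for \<eta>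
  proof -
    from L2_dense.approx[OF L2_dense_jacobi[OF \<alpha>\<beta>] fL2] that
    obtain g where g: "g \<in> span (range ?e)" "L2_inner ?M (\<lambda>x. f x - g x) (\<lambda>x. f x - g x) < \<eta>"
      unfolding L2_approx_def by blast
    obtain F c where F: "finite F" "g = (\<lambda>x. \<Sum>k\<in>F. c k * ?e k x)"
      using span_range_lincomb[OF g(1)] by blast
    \<comment> \<open>Extension by zero expresses \<open>g\<close> over the larger index set
      \<open>F \<union> K\<close>, where the truncation to \<open>K\<close> can be compared with
      it.\<close>
    define c' where "c' k = (if k \<in> F then c k else 0)" for k
    let ?I = "F \<union> K"
    have I: "finite ?I" using F(1) \<open>finite K\<close> by simp
    have "g = (\<lambda>x. \<Sum>k\<in>?I. c' k * ?e k x)"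
      unfolding F(2) using I by (intro ext sum.mono_neutral_cong_left) (auto simp: c'_def)
    with g(2) have "L2_inner ?M f f - (\<Sum>k\<in>?I. (?f k)\<^sup>2) + (\<Sum>k\<in>?I. (?f k - c' k)\<^sup>2) < \<eta>"
      using dist[OF I, of c'] by simp
    moreover have "0 \<le> (\<Sum>k\<in>?I. (?f k - c' k)\<^sup>2)" by (intro sum_nonneg) auto
    ultimately have 1: "L2_inner ?M f f - (\<Sum>k\<in>?I. (?f k)\<^sup>2) < \<eta>" by linarith
    have "(\<Sum>k\<in>?I - K. (?f k)\<^sup>2)
        \<le> (\<Sum>k\<in>?I - K. \<epsilon>\<^sup>2 * (lambda_a a k powr (2 * r) * \<bar>?f k\<bar>\<^sup>2))"
    proof (rule sum_mono)
      fix k assume "k \<in> ?I - K"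
      then show "(?f k)\<^sup>2
          \<le> \<epsilon>\<^sup>2 * (lambda_a a k powr (2 * r) * \<bar>?f k\<bar>\<^sup>2)"
        using mult_right_mono[OF K, of k "(?f k)\<^sup>2"] by (simp add: mult.assoc)
    qed
    also have "\<dots> \<le> \<epsilon>\<^sup>2 * (\<Sum>\<^sub>\<infinity>k. lambda_a a k powr (2 * r) * \<bar>?f k\<bar>\<^sup>2)"
      unfolding sum_distrib_left[symmetric]
      using I by (intro mult_left_mono finite_sum_le_infsum summ) auto
    also have "\<dots> \<le> \<epsilon>\<^sup>2"
        using mult_left_mono[OF le1, of "\<epsilon>\<^sup>2"] by simp
    finally have 2: "(\<Sum>k\<in>?I - K. (?f k)\<^sup>2) \<le> \<epsilon>\<^sup>2" .
    have "(\<Sum>k\<in>?I. (?f k)\<^sup>2)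
        = (\<Sum>k\<in>?I - K. (?f k)\<^sup>2) + (\<Sum>k\<in>K. (?f k)\<^sup>2)"
      using I by (intro sum.subset_diff) auto
    moreover have "L2_inner ?M ?D ?D = L2_inner ?M f f - (\<Sum>k\<in>K. (?f k)\<^sup>2)"
      using dist[OF \<open>finite K\<close>, of ?f] by simp
    ultimately show ?thesis using 1 2 by linarith
  qed
  then have "L2_inner ?M ?D ?D \<le> \<epsilon>\<^sup>2" by (rule field_le_epsilon)
  moreover have "f - (\<Sum>k\<in>K. ?f k *\<^sub>R ?e k) = ?D"
    by (auto simp: fun_eq_iff sum_fun_apply scaleR_fun_def)
  ultimately show ?thesis
    using \<open>\<epsilon> > 0\<close> by (simp add: L2_norm_def real_le_lsqrt)
qed

text \<open>The span of the tensors indexed by \<open>K\<close> competes in the infimum; the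
  truncated expansion of each \<open>f\<close> is the witness for its distance to that span.\<close>

lemma n_eps_U_ball_le_card:
  fixes K :: "(nat ^ 's) set"
  assumes "\<alpha> > -1" "\<beta> > -1" "finite K" "\<epsilon> > 0"
    and K: "\<And>k. k \<notin> K
        \<Longrightarrow> 1 \<le> \<epsilon>\<^sup>2 * lambda_a a k powr (2 * r)"
  shows "n_eps \<epsilon> (U_ball \<alpha> \<beta> r a :: (real ^ 's \<Rightarrow> real) set)
    (L2_space (jacobi_measure \<alpha> \<beta>)) (L2_norm (jacobi_measure \<alpha> \<beta>))
        \<le> enat (card K)"
proof -
  let ?L = "span (jacobi_tensor \<alpha> \<beta> ` K) :: (real ^ 's \<Rightarrow> real) set"
  let ?N = "L2_norm (jacobi_measure \<alpha> \<beta>) :: (real ^ 's \<Rightarrow> real) \<Rightarrow> real"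
  have "?L \<subseteq> L2_space (jacobi_measure \<alpha> \<beta>)"
    using assms(1,2) by (intro span_minimal subspace_L2_space) (auto
        simp: jacobi_tensor_eq poly_tensor_L2)
  moreover have "dim_at_most ?L (card K)"
    using finite_span_dim_at_most[of "jacobi_tensor \<alpha> \<beta> ` K"] card_image_le[OF \<open>finite K\<close>, of "jacobi_tensor \<alpha> \<beta>"] \<open>finite K\<close>
    unfolding dim_at_most_def by (meson finite_imageI order_trans)
  moreover have "(SUP f\<in>U_ball \<alpha> \<beta> r a. INF g\<in>?L. ereal (?N (f - g)))
      \<le> ereal \<epsilon>"
  proof (intro SUP_least)
    fix f :: "real ^ 's \<Rightarrow> real" assume f: "f \<in> U_ball \<alpha> \<beta> r a"
    let ?g = "\<Sum>k\<in>K. jacobi_coeff \<alpha> \<beta> f k *\<^sub>R jacobi_tensor \<alpha> \<beta> k"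
    have "?g \<in> ?L" by (intro span_sum span_scale span_base) auto
    then have "(INF g\<in>?L. ereal (?N (f - g))) \<le> ereal (?N (f - ?g))" by (rule INF_lower)
    also have "\<dots> \<le> ereal \<epsilon>"
      using L2_norm_jacobi_truncation[OF assms(1,2) f assms(3,4) K] by simp
    finally show "(INF g\<in>?L. ereal (?N (f - g))) \<le> ereal \<epsilon>" .
  qed
  ultimately show ?thesis
    unfolding n_eps_def by (intro INF_lower) (auto intro!: exI[of _ ?L] subspace_span)
qed

theorem theorem6p6:
  fixes \<alpha> \<beta> a r q lam \<epsilon> :: real
  assumes "\<alpha> > -1" and "\<beta> > -1"
    and "a = (\<alpha> + \<beta> + 1) / 2" and "a > 0"
    and "r > 0"
    and "q \<ge> 1"
    and "lam = a - 1 / q" and "lam > 0"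
    and "0 < \<epsilon>" and "\<epsilon> \<le> 1"
  shows "ereal_of_enat (n_eps \<epsilon> (U_ball \<alpha> \<beta> r a :: (real ^ 's \<Rightarrow> real) set)
            (L2_space (jacobi_measure \<alpha> \<beta>)) (L2_norm (jacobi_measure \<alpha> \<beta>)))
         \<le> ereal (q * lam powr (- (q * real CARD('s))) * \<epsilon> powr (- (1 + q) / r))"
proof -
  \<comment> \<open>The threshold at which \<open>\<epsilon>\<^sup>2 * T powr (2 * r) = 1\<close>,
    so that the truncation lemma applies to every index with
    \<open>lambda_a a k \<ge> T\<close>.\<close>
  define T where "T = \<epsilon> powr (- (1 / r))"
  define K where "K = {k :: nat ^ 's. lambda_a a k < T}"
  let ?b = "lam powr (- (q * real CARD('s))) * \<epsilon> powr (- (1 + q) / r)"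
  have T: "T > 0" using \<open>0 < \<epsilon>\<close> by (simp add: T_def)
  have K: "finite K" "real (card K) \<le> T powr (1 + q) * lam powr (- (q * real CARD('s)))"
    using hyperbolic_cross_finite_card[where 's = 's, OF \<open>q \<ge> 1\<close> _ T, of a] \<open>lam > 0\<close>
    unfolding \<open>lam = a - 1 / q\<close> K_def by blast+
  have "1 \<le> \<epsilon>\<^sup>2 * lambda_a a k powr (2 * r)" if "k \<notin> K" for k
  proof -
    have "T powr (2 * r) = \<epsilon> powr (- 2)"
      using assms by (simp add: T_def powr_powr)
    then have "1 = \<epsilon>\<^sup>2 * T powr (2 * r)"
      using assms by (simp add: powr_minus)
    also have "\<dots> \<le> \<epsilon>\<^sup>2 * lambda_a a k powr (2 * r)"
      using that T \<open>r > 0\<close> by (intro mult_left_mono powr_mono2) (auto simp: K_def)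
    finally show ?thesis .
  qed
  then have "n_eps \<epsilon> (U_ball \<alpha> \<beta> r a :: (real ^ 's \<Rightarrow> real) set)
      (L2_space (jacobi_measure \<alpha> \<beta>)) (L2_norm (jacobi_measure \<alpha> \<beta>))
          \<le> enat (card K)"
    using assms K(1) by (intro n_eps_U_ball_le_card)
  then have "ereal_of_enat (n_eps \<epsilon> (U_ball \<alpha> \<beta> r a :: (real ^ 's \<Rightarrow> real) set)
      (L2_space (jacobi_measure \<alpha> \<beta>)) (L2_norm (jacobi_measure \<alpha> \<beta>)))
          \<le> ereal (real (card K))"
    by (metis ereal_of_enat_le_iff ereal_of_enat_simps(1))
  also have "\<dots> \<le> ereal (q * lam powr (- (q * real CARD('s))) * \<epsilon> powr (- (1 + q) / r))"
  proof -
    have "- (1 / r) * (1 + q) = - (1 + q) / r"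
      by (simp only: mult_minus_left minus_divide_left[symmetric] times_divide_eq_left mult_1)
    then have "T powr (1 + q) = \<epsilon> powr (- (1 + q) / r)"
      unfolding T_def powr_powr by (rule arg_cong)
    with K(2) have "real (card K) \<le> ?b" by (simp add: mult.commute)
    \<comment> \<open>As \<open>q \<ge> 1\<close> and \<open>?b\<close> is nonnegative, the factor
      \<open>q\<close> only enlarges the bound.\<close>
    also have "?b \<le> q * ?b"
      using mult_right_mono[OF \<open>q \<ge> 1\<close>, of ?b] by simp
    finally show ?thesis by (simp add: mult.assoc)
  qed
  finally show ?thesis .
qed

end
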